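(* Let $\varepsilon\in(0,1)$, $t\in(0,1/8]$, and let $G$ be a connected edge-weighted graph with diameter $\Delta$ that has a width-$(t\varepsilon\Delta)$ gridtree hierarchy. Then there is a clustering $\mathcal{C}$ of $G$ such that (i) every cluster of $\mathcal{C}$ has strong diameter $O(\varepsilon\Delta)$, and (ii) for all $u,v\in V(G)$, $$\mathrm{cost}_{8t,\mathcal{C}}(u,v)=O\!\left(\frac{1}{t\varepsilon}\right)\cdot\frac{\delta_G(u,v)}{\Delta}+O(1),$$ where the $O(\cdot)$ hide absolute constants.
   Context: Let $H$ be a connected edge-weighted graph and $w>0$. A $w$-gridtree for $H$ consists of a partition of $V(H)$ into disjoint subsets, each designated either a column or a leftover set, together with a rooted tree $\mathcal{T}$ whose nodes are in one-to-one correspondence with the columns and whose edges are in one-to-one correspondence with the leftover sets, satisfying: (Column adjacency) For every edge $(u,v)$ of $H$: either $u,v$ lie in the same subset, or $u,v$ lie in columns adjacent in $\mathcal{T}$, or one lies in a column $\eta$ and the other in a leftover set whose edge of $\mathcal{T}$ is incident to $\eta$. (Column width) For a column $\eta$, every other column and every edge of $\mathcal{T}$ is either below $\eta$ (in the subtree of $\mathcal{T}$ rooted at $\eta$; for edges, both endpoints in that subtree) or above $\eta$ (otherwise); a vertex is above/below $\eta$ if its column or leftover set is. If $a\in\eta$ is adjacent in $H$ to a vertex above $\eta$, $b$ is a vertex below $\eta$, and $P$ is a path in $H$ from $a$ to $b$, then $P$ has length at least $w$. (Column shortcut) For a column $\eta$, let $H_\eta$ be the subgraph of $H$ induced by $\eta$,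 all columns below $\eta$, and all leftover sets below $\eta$ or incident to $\eta$. There is a shortest path $\pi_\eta$ of $H_\eta$ such that every vertex of $\eta$ is within distance $2w$ of $\pi_\eta$ in the induced subgraph $H[\eta]$. A width-$w$ gridtree hierarchy $\mathcal{H}$ of $G$ is a rooted tree whose nodes are pairs $\mu=(H^\mu,\mathcal{T}^\mu)$, with $H^\mu$ a connected subgraph of $G$ and $\mathcal{T}^\mu$ a $w$-gridtree for $H^\mu$, the root being associated with $G$ itself, such that: (Layer nesting) the children of $\mu$ are in one-to-one correspondence with the connected components of the subgraphs of $H^\mu$ induced by the leftover sets of $\mathcal{T}^\mu$, each child $\mu'$ having $H^{\mu'}$ equal to its component; (Layer width) a vertex $v$ of $H^\mu$ is an outer vertex if it is adjacent in $G$ to a vertex in a column of $\mathcal{T}^{\mathrm{Pa}(\mu)}$, where $\mathrm{Pa}(\mu)$ is the parent (the root has no outer vertices); every vertex $u$ of $H^\mu$ with $\mathrm{dist}_{H^\mu}(u,v)\le w$ for some outer vertex $v$ of $H^\mu$ belongs to a column of $\mathcal{T}^\mu$. A cluster is a vertex set $C$ with $G[C]$ connected; a clustering is a partition of $V(G)$ into clusters; $C$ has strong diameter at most $D$ if $\delta_{G[C]}(x,y)\le D$ for all $x,y\in C$. The cluster graph $\check G$ contracts every cluster to a node and is unweighted. The cost $\mathrm{cost}_{\mathcal{C}}(P)$ of a path $P$ in $G$ from $u$ to $v$ is the minimum hop-length of a path in $\check G$ from the cluster containing $u$ to the cluster containing $v$ using only clusters that contain a vertex of $P$. For $s\ge0$,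 $\mathrm{cost}_{s,\mathcal{C}}(u,v)$ is the minimum of $\mathrm{cost}_{\mathcal{C}}(P)$ over all paths $P$ from $u$ to $v$ of length at most $(1+s)\,\delta_G(u,v)$. *)

theory Defs
  imports Main "HOL.Real"
begin

definition wgraph :: "nat set \<Rightarrow> (nat \<times> nat) set \<Rightarrow> (nat \<Rightarrow> nat \<Rightarrow> real) \<Rightarrow> bool" where
  "wgraph V E wt \<longleftrightarrow> finite V \<and> E \<subseteq> V \<times> V \<and> sym E \<and> (\<forall>x. (x, x) \<notin> E) \<and>
     (\<forall>u v. (u, v) \<in> E \<longrightarrow> wt u v > 0 \<and> wt u v = wt v u)"

definition is_path :: "(nat \<times> nat) set \<Rightarrow> nat set \<Rightarrow> nat list \<Rightarrow> nat \<Rightarrow> nat \<Rightarrow> bool" where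
  "is_path E S xs u v \<longleftrightarrow> xs \<noteq> [] \<and> distinct xs \<and> set xs \<subseteq> S \<and>
     successively (\<lambda>x y. (x, y) \<in> E) xs \<and> hd xs = u \<and> last xs = v"

definition plen :: "(nat \<Rightarrow> nat \<Rightarrow> real) \<Rightarrow> nat list \<Rightarrow> real" where
  "plen wt xs = sum_list (map (\<lambda>(x, y). wt x y) (zip xs (tl xs)))"

definition connected_in :: "(nat \<times> nat) set \<Rightarrow> nat set \<Rightarrow> bool" where
  "connected_in E S \<longleftrightarrow> S \<noteq> {} \<and> (\<forall>u\<in>S. \<forall>v\<in>S. \<exists>xs. is_path E S xs u v)"

definition dist_in :: "(nat \<times> nat) set \<Rightarrow> (nat \<Rightarrow> nat \<Rightarrow> real) \<Rightarrow> nat set \<Rightarrow> nat \<Rightarrow> nat \<Rightarrow> real" where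
  "dist_in E wt S u v = Inf {plen wt xs | xs. is_path E S xs u v}"

definition diameter :: "(nat \<times> nat) set \<Rightarrow> (nat \<Rightarrow> nat \<Rightarrow> real) \<Rightarrow> nat set \<Rightarrow> real" where
  "diameter E wt V = Sup {dist_in E wt V u v | u v. u \<in> V \<and> v \<in> V}"

definition component :: "(nat \<times> nat) set \<Rightarrow> nat set \<Rightarrow> nat set \<Rightarrow> bool" where
  "component E S K \<longleftrightarrow> K \<subseteq> S \<and> connected_in E K \<and> (\<forall>x\<in>K. \<forall>y\<in>S - K. (x, y) \<notin> E)"

text \<open>The tree has node set N (finite), root r, parent function par (par r = r).
  Node i carries the column col i; each non-root node i represents the tree edge
  {i, par i}, which carries the leftover set lft i.\<close>

definition subtree :: "nat set \<Rightarrow> (nat \<Rightarrow> nat) \<Rightarrow> nat \<Rightarrow> nat set" where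
  "subtree N par i = {j \<in> N. \<exists>n. (par ^^ n) j = i}"

definition below_verts :: "nat set \<Rightarrow> (nat \<Rightarrow> nat) \<Rightarrow> (nat \<Rightarrow> nat set) \<Rightarrow> (nat \<Rightarrow> nat set) \<Rightarrow> nat \<Rightarrow> nat set" where
  "below_verts N par col lft i =
     (\<Union>j\<in>subtree N par i - {i}. col j) \<union> (\<Union>j\<in>subtree N par i - {i}. lft j)"

definition above_verts :: "nat set \<Rightarrow> nat set \<Rightarrow> (nat \<Rightarrow> nat) \<Rightarrow> (nat \<Rightarrow> nat set) \<Rightarrow> (nat \<Rightarrow> nat set) \<Rightarrow> nat \<Rightarrow> nat set" where
  "above_verts X N par col lft i = X - col i - below_verts N par col lft i"

definition gridtree ::
  "(nat \<times> nat) set \<Rightarrow> (nat \<Rightarrow> nat \<Rightarrow> real) \<Rightarrow> real \<Rightarrow> nat set \<Rightarrow>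
   nat set \<Rightarrow> nat \<Rightarrow> (nat \<Rightarrow> nat) \<Rightarrow> (nat \<Rightarrow> nat set) \<Rightarrow> (nat \<Rightarrow> nat set) \<Rightarrow> bool" where
  "gridtree E wt w X N r par col lft \<longleftrightarrow>
     w > 0 \<and>
     \<comment> \<open>rooted tree\<close>
     finite N \<and> r \<in> N \<and> par r = r \<and> (\<forall>i\<in>N - {r}. par i \<in> N) \<and>
     (\<forall>i\<in>N. \<exists>n. (par ^^ n) i = r) \<and>
     \<comment> \<open>partition of X into columns and leftover sets\<close>
     (\<forall>i\<in>N. col i \<noteq> {}) \<and> (\<forall>i\<in>N - {r}. lft i \<noteq> {}) \<and>
     (\<forall>i\<in>N. \<forall>j\<in>N. i \<noteq> j \<longrightarrow> col i \<inter> col j = {}) \<and>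
     (\<forall>i\<in>N - {r}. \<forall>j\<in>N - {r}. i \<noteq> j \<longrightarrow> lft i \<inter> lft j = {}) \<and>
     (\<forall>i\<in>N. \<forall>j\<in>N - {r}. col i \<inter> lft j = {}) \<and>
     (\<Union>i\<in>N. col i) \<union> (\<Union>i\<in>N - {r}. lft i) = X \<and>
     \<comment> \<open>column adjacency\<close>
     (\<forall>u v. (u, v) \<in> E \<longrightarrow> u \<in> X \<longrightarrow> v \<in> X \<longrightarrow>
        (\<exists>i\<in>N. u \<in> col i \<and> v \<in> col i) \<or>
        (\<exists>i\<in>N - {r}. u \<in> lft i \<and> v \<in> lft i) \<or>
        (\<exists>i\<in>N. \<exists>j\<in>N. u \<in> col i \<and> v \<in> col j \<and> ((i \<noteq> r \<and> par i = j) \<or> (j \<noteq> r \<and> par j = i))) \<or>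
        (\<exists>i\<in>N. \<exists>j\<in>N - {r}. u \<in> col i \<and> v \<in> lft j \<and> (j = i \<or> par j = i)) \<or>
        (\<exists>i\<in>N. \<exists>j\<in>N - {r}. v \<in> col i \<and> u \<in> lft j \<and> (j = i \<or> par j = i))) \<and>
     \<comment> \<open>column width\<close>
     (\<forall>i\<in>N. \<forall>a\<in>col i. \<forall>a'. (a, a') \<in> E \<longrightarrow> a' \<in> above_verts X N par col lft i \<longrightarrow>
        (\<forall>b\<in>below_verts N par col lft i. \<forall>P. is_path E X P a b \<longrightarrow> plen wt P \<ge> w)) \<and>
     \<comment> \<open>column shortcut\<close>
     (\<forall>i\<in>N. let S = (\<Union>j\<in>subtree N par i. col j) \<union> (\<Union>j\<in>subtree N par i - {r}. lft j) in
        \<exists>\<pi> u v. is_path E S \<pi> u v \<and> (\<forall>P. is_path E S P u v \<longrightarrow> plen wt \<pi> \<le> plen wt P) \<and>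
          (\<forall>x\<in>col i. \<exists>y\<in>set \<pi> \<inter> col i. \<exists>Q. is_path E (col i) Q x y \<and> plen wt Q \<le> 2 * w))"

text \<open>hier E wt w X C: the induced subgraph on X is the graph of a node of a width-w gridtree
  hierarchy (together with its whole subtree of the hierarchy), where C is the set of vertices
  lying in columns of the gridtree of the parent node (C = {} for the root).\<close>
inductive hier :: "(nat \<times> nat) set \<Rightarrow> (nat \<Rightarrow> nat \<Rightarrow> real) \<Rightarrow> real \<Rightarrow> nat set \<Rightarrow> nat set \<Rightarrow> bool"
  for E wt w where
  "\<lbrakk> connected_in E X;
     gridtree E wt w X N r par col lft;
     \<forall>u\<in>X. (\<exists>v\<in>X. (\<exists>c\<in>C. (v, c) \<in> E) \<and> (\<exists>P. is_path E X P u v \<and> plen wt P \<le> w))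
             \<longrightarrow> u \<in> (\<Union>i\<in>N. col i);
     \<forall>j K. j \<in> N - {r} \<longrightarrow> component E (lft j) K \<longrightarrow> hier E wt w K (\<Union>i\<in>N. col i) \<rbrakk>
   \<Longrightarrow> hier E wt w X C"

definition has_gridtree_hierarchy :: "nat set \<Rightarrow> (nat \<times> nat) set \<Rightarrow> (nat \<Rightarrow> nat \<Rightarrow> real) \<Rightarrow> real \<Rightarrow> bool" where
  "has_gridtree_hierarchy V E wt w \<longleftrightarrow> hier E wt w V {}"

definition clustering :: "(nat \<times> nat) set \<Rightarrow> nat set \<Rightarrow> nat set set \<Rightarrow> bool" where
  "clustering E V \<C> \<longleftrightarrow> (\<forall>C\<in>\<C>. connected_in E C) \<and> \<Union>\<C> = V \<and> pairwise disjnt \<C>"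

definition strong_diam_le :: "(nat \<times> nat) set \<Rightarrow> (nat \<Rightarrow> nat \<Rightarrow> real) \<Rightarrow> nat set \<Rightarrow> real \<Rightarrow> bool" where
  "strong_diam_le E wt C D \<longleftrightarrow> (\<forall>x\<in>C. \<forall>y\<in>C. dist_in E wt C x y \<le> D)"

definition cluster_of :: "nat set set \<Rightarrow> nat \<Rightarrow> nat set" where
  "cluster_of \<C> x = (THE C. C \<in> \<C> \<and> x \<in> C)"

definition cadj :: "(nat \<times> nat) set \<Rightarrow> nat set \<Rightarrow> nat set \<Rightarrow> bool" where
  "cadj E C1 C2 \<longleftrightarrow> C1 \<noteq> C2 \<and> (\<exists>x\<in>C1. \<exists>y\<in>C2. (x, y) \<in> E)"

definition path_cost :: "(nat \<times> nat) set \<Rightarrow> nat set set \<Rightarrow> nat list \<Rightarrow> nat \<Rightarrow> nat \<Rightarrow> nat" where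
  "path_cost E \<C> P u v = (LEAST k. \<exists>cs. length cs = Suc k \<and> set cs \<subseteq> \<C> \<and>
      (\<forall>C\<in>set cs. C \<inter> set P \<noteq> {}) \<and> successively (cadj E) cs \<and>
      hd cs = cluster_of \<C> u \<and> last cs = cluster_of \<C> v)"

definition cost_s :: "(nat \<times> nat) set \<Rightarrow> (nat \<Rightarrow> nat \<Rightarrow> real) \<Rightarrow> nat set \<Rightarrow> nat set set \<Rightarrow> real \<Rightarrow> nat \<Rightarrow> nat \<Rightarrow> nat" where
  "cost_s E wt V \<C> s u v = (LEAST k. \<exists>P. is_path E V P u v \<and>
      plen wt P \<le> (1 + s) * dist_in E wt V u v \<and> path_cost E \<C> P u v = k)"

end

(* Write w for the width. Encode the whole hierarchy as a laminar family of pairs (eta, S), where eta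
   is a column and S the vertex set of H_eta. The width conditions bound, in terms of B/w, the number
   of columns eta whose distance to a given vertex inside S is at most B.
   Clusters of radius 3w are grown column by column, from the root downwards: the shortest path of a
   column is cut into cells of length w/10; a cell without assigned vertices founds a cluster, any other
   cell is absorbed by clusters it meets, and then the rest of the column is attached along the paths of
   length 2w. Absorption can be iterated only boundedly often, since each iteration produces a
   further column at distance less than w.
   A path of length at most w lies in S and meets eta for some (eta, S). It meets boundedly many
   clusters founded by columns above or equal to eta, and the pieces of the path between them avoid eta,
   so that induction applies; the depth is bounded because all the columns eta found on the way are
   within w of one vertex. Thus a path of length L costs O(L/w + 1), and no stretch is needed. *)

theory Submission
  imports Defs
begin

section \<open>Walks, distances and geodesics\<close>


text \<open>Everything rests on one count. Inside one gridtree, column width leaves at most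
  \<open>B / w + 2\<close> columns within \<open>B\<close> of a vertex; between two consecutive
  layer boundaries a path is longer than \<open>w\<close> by layer width, and the sum over the
  layers is at most \<open>(B / w + 2)^2\<close> whatever the depth. The obstacle is that the
  shortest path of a column may run outside the column, so later columns find parts of their
  subgraph already assigned. Founding clusters in the gaps would leave no bound on their number per
  cell; therefore a cell that meets an assigned vertex is absorbed. The count below scale
  \<open>w\<close> stops the absorption: nine columns within \<open>9 / 10 * w\<close> would exceed
  \<open>(29 / 10)^2 = 8.41\<close>, which explains the cells of length \<open>w / 10\<close>.
  Vertices attached over distance \<open>2 * w\<close> lie in a processed column, which no later
  subgraph meets, so this larger step is never repeated. The count also fixes the other constants:
  \<open>(4 + 2)^2 = 36\<close> columns can found the clusters counted near a short path, and
  \<open>(1 + 2)^2 = 9\<close> bounds the depth of the recursion.\<close>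

lemma plen_simps [simp]:
  "plen wt [] = 0" "plen wt [x] = 0" "plen wt (x # y # zs) = wt x y + plen wt (y # zs)"
  by (simp_all add: plen_def)

lemma plen_append:
  "xs \<noteq> [] \<Longrightarrow> ys \<noteq> [] \<Longrightarrow> plen wt (xs @ ys) = plen wt xs + wt (last xs) (hd ys) + plen wt ys"
proof (induction xs)
  case (Cons x xs)
  then show ?case by (cases xs; cases ys) auto
qed simp

lemma plen_split: "plen wt (xs @ y # ys) = plen wt (xs @ [y]) + plen wt (y # ys)"
  by (cases "xs = []"; cases ys) (auto simp: plen_append)

lemma is_pathD:
  assumes "is_path E S P u v"
  shows "P \<noteq> []" "distinct P" "set P \<subseteq> S" "successively (\<lambda>x y. (x, y) \<in> E) P"
    "hd P = u" "last P = v" "u \<in> set P" "v \<in> set P"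
  using assms by (auto simp: is_path_def)

lemma is_path_suffix:
  assumes "is_path E S (xs @ y # ys) u v" "set (y # ys) \<subseteq> D"
  shows "is_path E D (y # ys) y v"
  using assms by (auto simp: is_path_def successively_append_iff)

lemma is_path_prefix:
  assumes "is_path E S (xs @ y # ys) u v"
  shows "is_path E S (xs @ [y]) u y"
  using assms by (auto simp: is_path_def successively_append_iff hd_append)

text \<open>Cutting after the last vertex outside \<open>D\<close>, not before the first one inside,
  leaves a suffix that is a path of the subgraph induced by \<open>D\<close>. Columns and components
  are always entered in this way.\<close>

lemma last_entry:
  assumes P: "is_path E S P u v" and "u \<notin> D" "v \<in> D"
  obtains xs y z zs where "P = xs @ y # z # zs" "y \<notin> D" "set (z # zs) \<subseteq> D" "(y, z) \<in> E"
    "y \<in> S" "z \<in> S"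
proof -
  have "\<exists>x\<in>set P. x \<notin> D"
    using is_pathD(7)[OF P] assms by auto
  then obtain xs y zs where *: "P = xs @ y # zs" "y \<notin> D" "\<forall>z\<in>set zs. z \<in> D"
    using split_list_last_prop[of P "\<lambda>x. x \<notin> D"] by blast
  have "zs \<noteq> []"
    using * is_pathD(6)[OF P] assms by auto
  then obtain z zs' where z: "zs = z # zs'"
    by (cases zs) auto
  show thesis
    using is_pathD[OF P] * z by (intro that[of xs y z zs']) (auto simp: successively_append_iff)
qed

lemma card_le_from_subset: "finite B \<Longrightarrow> A \<subseteq> B \<Longrightarrow> real (card B) \<le> c \<Longrightarrow> real (card A) \<le> c"
  by (meson card_mono le_trans of_nat_mono order_trans)

text \<open>A bounded distance stated through a witness path, since \<open>dist_in\<close> is an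
  infimum and carries no information when \<open>S\<close> does not connect the two
  vertices.\<close>

definition near ::
  "(nat \<times> nat) set \<Rightarrow> (nat \<Rightarrow> nat \<Rightarrow> real) \<Rightarrow> nat set \<Rightarrow> real \<Rightarrow> nat \<Rightarrow> nat \<Rightarrow> bool" where
  "near E wt S d u v \<longleftrightarrow> (\<exists>P. is_path E S P u v \<and> plen wt P \<le> d)"

section \<open>Walks, their reduction to paths, and distances inside induced subgraphs\<close>

locale weighted_graph =
  fixes V :: "nat set" and E :: "(nat \<times> nat) set" and wt :: "nat \<Rightarrow> nat \<Rightarrow> real"
  assumes wgraph: "wgraph V E wt"
begin

abbreviation "walk \<equiv> successively (\<lambda>x y. (x, y) \<in> E)"
abbreviation "nr \<equiv> near E wt"

lemma finite_V: "finite V" and E_sub: "(u, v) \<in> E \<Longrightarrow> u \<in> V \<and> v \<in> V"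
  and E_sym: "(u, v) \<in> E \<Longrightarrow> (v, u) \<in> E" and E_irrefl: "(u, u) \<notin> E"
  and wt_pos: "(u, v) \<in> E \<Longrightarrow> wt u v > 0" and wt_sym: "(u, v) \<in> E \<Longrightarrow> wt u v = wt v u"
  using wgraph unfolding wgraph_def by (auto dest: symD)

lemma plen_nonneg: "walk xs \<Longrightarrow> plen wt xs \<ge> 0"
proof (induction xs rule: induct_list012)
  case (3 x y zs)
  then show ?case using wt_pos[of x y] by auto
qed auto

lemma plen_infix_le:
  assumes "walk (xs @ ys @ zs)" shows "plen wt ys \<le> plen wt (xs @ ys @ zs)"
proof -
  have "plen wt ys \<le> plen wt (ys @ zs)" if "walk (ys @ zs)" for ys zs
  proof (cases "ys = [] \<or> zs = []")
    case False
    then have "(last ys, hd zs) \<in> E" "walk zs"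
      using that by (auto simp: successively_append_iff)
    then show ?thesis
      using False plen_nonneg[of zs] wt_pos[of "last ys" "hd zs"] by (simp add: plen_append)
  qed (use plen_nonneg[OF that] in auto)
  moreover have "plen wt ys \<le> plen wt (xs @ ys)" if "walk (xs @ ys)" for ys
  proof (cases "ys = [] \<or> xs = []")
    case False
    then have "(last xs, hd ys) \<in> E" "walk xs"
      using that by (auto simp: successively_append_iff)
    then show ?thesis
      using False plen_nonneg[of xs] wt_pos[of "last xs" "hd ys"] by (simp add: plen_append)
  qed (use plen_nonneg[OF that] in auto)
  ultimately show ?thesis
    using assms by (metis order_trans successively_append_iff)
qed

lemma walk_rev: "walk xs \<Longrightarrow> walk (rev xs)"
  unfolding successively_rev by (erule successively_mono) (auto intro: E_sym)

lemma plen_rev: "walk xs \<Longrightarrow> plen wt (rev xs) = plen wt xs"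
proof (induction xs rule: induct_list012)
  case (3 x y zs)
  then show ?case using wt_sym[of x y] plen_split[of wt "rev zs" y "[x]"] by simp
qed auto

lemma is_path_rev: "is_path E S P u v \<Longrightarrow> is_path E S (rev P) v u"
  using walk_rev by (auto simp: is_path_def hd_rev last_rev)

text \<open>\<open>is_path\<close> demands distinct vertices, so concatenated paths are only walks.
  Cutting out the part between two visits of a vertex does not lengthen the walk, because weights
  are positive.\<close>

lemma walk_to_path:
  assumes "xs \<noteq> []" "walk xs"
  shows "\<exists>P. is_path E (set xs) P (hd xs) (last xs) \<and> plen wt P \<le> plen wt xs"
  using assms
proof (induction "length xs" arbitrary: xs rule: less_induct)
  case less
  show ?case
  proof (cases "distinct xs")
    case True
    then show ?thesis using less.prems by (intro exI[of _ xs]) (auto simp: is_path_def)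
  next
    case False
    then obtain as a bs cs where xs: "xs = as @ [a] @ bs @ [a] @ cs"
      using not_distinct_decomp by blast
    let ?ys = "as @ a # cs"
    have w: "walk ?ys"
      using less.prems(2) unfolding xs by (auto simp: successively_append_iff successively_Cons hd_append split: if_splits)
    obtain P where P: "is_path E (set ?ys) P (hd ?ys) (last ?ys)" "plen wt P \<le> plen wt ?ys"
      using less.hyps[of ?ys] w xs by fastforce
    have "plen wt xs = plen wt (as @ [a]) + plen wt (a # bs @ a # cs)"
      unfolding xs using plen_split[of wt as a "bs @ a # cs"] by simp
    also have "plen wt (a # bs @ a # cs) = plen wt ((a # bs) @ [a]) + plen wt (a # cs)"
      using plen_split[of wt "a # bs" a cs] by simp
    finally have "plen wt xs = plen wt ((a # bs) @ [a]) + plen wt ?ys"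
      using plen_split[of wt as a cs] by simp
    moreover have "plen wt ((a # bs) @ [a]) \<ge> 0"
      using less.prems(2) unfolding xs
      by (intro plen_nonneg) (auto simp: successively_append_iff successively_Cons hd_append split: if_splits)
    moreover have "set ?ys \<subseteq> set xs" "hd ?ys = hd xs" "last ?ys = last xs"
      unfolding xs by (auto simp: hd_append last_append)
    ultimately show ?thesis
      using P by (intro exI[of _ P]) (auto simp: is_path_def dest: subsetD)
  qed
qed

lemma near_walk:
  "xs \<noteq> [] \<Longrightarrow> walk xs \<Longrightarrow> set xs \<subseteq> S \<Longrightarrow> plen wt xs \<le> d \<Longrightarrow> nr S d (hd xs) (last xs)"
  using walk_to_path[of xs] unfolding near_def is_path_def by (meson order_trans)

lemma near_refl: "u \<in> S \<Longrightarrow> 0 \<le> d \<Longrightarrow> nr S d u u"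
  using near_walk[of "[u]" S d] by auto

lemma near_sym: "nr S d u v \<Longrightarrow> nr S d v u"
  unfolding near_def using is_path_rev plen_rev is_pathD(4) by metis

lemma near_mono: "nr S d u v \<Longrightarrow> S \<subseteq> T \<Longrightarrow> d \<le> d' \<Longrightarrow> nr T d' u v"
proof -
  assume "nr S d u v" "S \<subseteq> T" "d \<le> d'"
  from \<open>nr S d u v\<close> obtain P where P: "is_path E S P u v" "plen wt P \<le> d"
    unfolding near_def by blast
  have "is_path E T P u v"
    using P(1) \<open>S \<subseteq> T\<close> unfolding is_path_def by auto
  then show ?thesis
    using P(2) \<open>d \<le> d'\<close> unfolding near_def by (intro exI[of _ P]) auto
qed

lemma near_nonneg: "nr S d u v \<Longrightarrow> 0 \<le> d"
  unfolding near_def by (meson is_pathD(4) order_trans plen_nonneg)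

lemma near_mem: "nr S d u v \<Longrightarrow> u \<in> S \<and> v \<in> S"
  unfolding near_def by (meson is_pathD(3,7,8) subsetD)

lemma near_trans:
  assumes "nr S d u v" "nr S e v x" shows "nr S (d + e) u x"
proof -
  obtain P Q where P: "is_path E S P u v" "plen wt P \<le> d" and Q: "is_path E S Q v x" "plen wt Q \<le> e"
    using assms unfolding near_def by blast
  obtain Q' where Q': "Q = v # Q'"
    using is_pathD(1,5)[OF Q(1)] by (cases Q) auto
  have P': "P = butlast P @ [v]"
    using is_pathD(1,6)[OF P(1)] by (metis append_butlast_last_id)
  let ?W = "butlast P @ v # Q'"
  have "plen wt ?W = plen wt P + plen wt Q"
    using plen_split[of wt "butlast P" v Q'] P' Q' by simp
  moreover have "walk ?W"
    using is_pathD(4)[OF P(1)] is_pathD(4)[OF Q(1)] Q'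
    by (subst (asm) P') (auto simp: successively_append_iff)
  moreover have "set ?W \<subseteq> S"
    using is_pathD(3)[OF P(1)] is_pathD(3)[OF Q(1)] Q' by (subst (asm) P') auto
  moreover have "hd ?W = u"
    using is_pathD(5)[OF P(1)] by (subst (asm) P') (auto simp: hd_append)
  moreover have "last ?W = x"
    using is_pathD(6)[OF Q(1)] Q' by simp
  ultimately show ?thesis
    using near_walk[of ?W S "d + e"] P(2) Q(2) by auto
qed

lemma near_edge: "(u, v) \<in> E \<Longrightarrow> u \<in> S \<Longrightarrow> v \<in> S \<Longrightarrow> nr S (wt u v) u v"
  using near_walk[of "[u, v]" S "wt u v"] by auto

lemma near_on_walk:
  assumes "walk P" "x \<in> set P" "y \<in> set P" "set P \<subseteq> S" "plen wt P \<le> d"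
  shows "nr S d x y"
proof -
  have *: "nr S d x y" if P: "P = as @ x # bs" "y \<in> set (x # bs)" for x y as bs
  proof -
    obtain cs ds where cd: "x # bs = cs @ y # ds"
      using P(2) by (meson split_list)
    have "P = as @ (cs @ [y]) @ ds"
      using P cd by simp
    then have "plen wt (cs @ [y]) \<le> d" "walk (cs @ [y])" "set (cs @ [y]) \<subseteq> S"
      using plen_infix_le[of as "cs @ [y]" ds] assms
      by (auto simp: successively_append_iff split: if_splits)
    moreover have "hd (cs @ [y]) = x"
      using cd by (cases cs) auto
    ultimately show ?thesis
      using near_walk[of "cs @ [y]" S d] by auto
  qed
  obtain as bs where P: "P = as @ x # bs"
    using assms(2) by (meson split_list)
  show ?thesis
  proof (cases "y \<in> set (x # bs)")
    case False
    then have "y \<in> set as"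
      using P assms(3) by auto
    then obtain cs ds where "as = cs @ y # ds"
      by (meson split_list)
    then show ?thesis
      using P *[of cs y "ds @ x # bs" x] near_sym by auto
  qed (use * P in blast)
qed

lemma finite_paths: "finite {P. is_path E S P u v}" if "S \<subseteq> V"
proof -
  have "{P. is_path E S P u v} \<subseteq> {xs. set xs \<subseteq> V \<and> length xs \<le> card V}"
    using that finite_V by (auto simp: is_path_def) (metis card_mono distinct_card order_trans)
  then show ?thesis
    using finite_lists_length_le[OF finite_V] finite_subset by blast
qed

text \<open>Only finitely many lists without repetition exist over a finite vertex set, so the
  infimum is a minimum.\<close>

lemma dist_in_attained:
  assumes "S \<subseteq> V" "is_path E S P u v"
  obtains Q where "is_path E S Q u v" "plen wt Q = dist_in E wt S u v" "plen wt Q \<le> plen wt P"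
proof -
  let ?A = "{plen wt xs | xs. is_path E S xs u v}"
  have fin: "finite ?A"
    using finite_imageI[OF finite_paths[OF assms(1)], of "plen wt"] by (simp add: image_Collect)
  have ne: "?A \<noteq> {}"
    using assms(2) by blast
  have "Inf ?A \<in> ?A" "Inf ?A \<le> plen wt P"
    using Min_in[OF fin ne] Min_le[OF fin, of "plen wt P"] assms(2) cInf_eq_Min[OF fin ne] by auto
  then show thesis
    using that unfolding dist_in_def by auto
qed

lemma dist_in_le: "S \<subseteq> V \<Longrightarrow> nr S d u v \<Longrightarrow> dist_in E wt S u v \<le> d"
  unfolding near_def by (metis dist_in_attained order_trans)

text \<open>A nearest-vertex assignment with consistent choices. Every vertex of \<open>Z\<close>
  copies the label of its successor on a chosen shortest path to \<open>Y\<close>, so following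
  successors stays in one label class and reaches \<open>Y\<close> within \<open>d\<close>. This
  yields small strong diameter, not merely small distances in the surrounding graph.\<close>

lemma voronoi_extension:
  fixes f :: "nat \<Rightarrow> 'a option"
  assumes ZY: "Z \<union> Y \<subseteq> V" and YD: "Y \<subseteq> dom f" and ZD: "Z \<inter> dom f = {}"
    and reach: "\<And>v. v \<in> Z \<Longrightarrow> \<exists>y\<in>Y. nr (Z \<union> Y) d v y"
  obtains f' where "f \<subseteq>\<^sub>m f'" "dom f' = dom f \<union> Z"
    "\<And>v. v \<in> Z \<Longrightarrow> \<exists>y\<in>Y. f' v = f y \<and> nr ((Z \<union> Y) \<inter> {x. f' x = f y}) d v y"
proof -
  define Q where "Q v P \<longleftrightarrow> (\<exists>y\<in>Y. is_path E (Z \<union> Y) P v y)" for v P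
  have min_ex: "\<exists>P. Q v P \<and> plen wt P \<le> d \<and> (\<forall>P'. Q v P' \<longrightarrow> plen wt P \<le> plen wt P')" if "v \<in> Z" for v
  proof -
    obtain P0 where P0: "Q v P0" "plen wt P0 \<le> d"
      using reach[OF \<open>v \<in> Z\<close>] unfolding Q_def near_def by blast
    have "{P. Q v P} = (\<Union>y\<in>Y. {P. is_path E (Z \<union> Y) P v y})"
      unfolding Q_def by blast
    moreover have "finite Y"
      using ZY finite_V finite_subset by blast
    ultimately have fin: "finite {P. Q v P}"
      using finite_paths[OF ZY] by simp
    obtain P where "P \<in> {P. Q v P}" "\<forall>P'\<in>{P. Q v P}. plen wt P \<le> plen wt P'"
      using ex_min_if_finite[OF finite_imageI[OF fin, of "plen wt"]] P0(1)
      by (auto simp: not_less)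
    then show ?thesis
      using P0 by (intro exI[of _ P]) (auto intro: order_trans)
  qed
  define P where "P v = (SOME P. Q v P \<and> plen wt P \<le> d \<and> (\<forall>P'. Q v P' \<longrightarrow> plen wt P \<le> plen wt P'))" for v
  have P: "Q v (P v)" "plen wt (P v) \<le> d" "Q v P' \<Longrightarrow> plen wt (P v) \<le> plen wt P'" if "v \<in> Z" for v P'
    using someI_ex[OF min_ex[OF that]] unfolding P_def by blast+
  define D where "D v = plen wt (P v)" for v
  \<comment> \<open>The tail of \<open>P v\<close> competes with the minimal path of its first
    vertex, so \<open>D\<close> drops by at least the weight of the edge.\<close>
  have nxt: "\<exists>n\<in>Z \<union> Y. (v, n) \<in> E \<and> wt v n \<le> D v \<and> (n \<in> Z \<longrightarrow> wt v n + D n \<le> D v)" if vZ: "v \<in> Z" for v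
  proof -
    obtain y where y: "y \<in> Y" "is_path E (Z \<union> Y) (P v) v y"
      using P(1)[OF vZ] unfolding Q_def by blast
    have "v \<noteq> y"
      using vZ y YD ZD by auto
    then obtain n ns where n: "P v = v # n # ns"
      using is_pathD(1,5,6)[OF y(2)] by (cases "P v"; cases "tl (P v)") auto
    have w: "walk (n # ns)" "(v, n) \<in> E" "n \<in> Z \<union> Y"
      using is_pathD(3,4)[OF y(2)] n by auto
    have "Q n (n # ns)"
      using y n unfolding Q_def is_path_def by (auto intro!: bexI[of _ y])
    then have "n \<in> Z \<longrightarrow> wt v n + D n \<le> D v"
      using P(3)[of n "n # ns"] n vZ unfolding D_def by auto
    then show ?thesis
      using w n plen_nonneg[OF w(1)] unfolding D_def by (intro bexI[of _ n]) auto
  qed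
  then obtain nxt where nxt: "\<And>v. v \<in> Z \<Longrightarrow> nxt v \<in> Z \<union> Y \<and> (v, nxt v) \<in> E \<and> wt v (nxt v) \<le> D v \<and>
      (nxt v \<in> Z \<longrightarrow> wt v (nxt v) + D (nxt v) \<le> D v)"
    by metis
  have fin_Z: "finite Z"
    using ZY finite_V finite_subset by blast
  \<comment> \<open>Induction over sets closed under successors, with vertices added by increasing
    \<open>D\<close>: a successor is labelled before the vertex that copies it.\<close>
  have "S \<subseteq> Z \<longrightarrow> (\<forall>v\<in>S. nxt v \<in> S \<union> Y) \<longrightarrow> (\<exists>f'. f \<subseteq>\<^sub>m f' \<and> dom f' = dom f \<union> S \<and>
    (\<forall>v\<in>S. \<exists>y\<in>Y. f' v = f y \<and> nr ((Z \<union> Y) \<inter> {x. f' x = f y}) (D v) v y))" if "finite S" for S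
    using that
  proof (induction S rule: finite_ranking_induct[where f = D])
    case empty
    then show ?case by (intro impI exI[of _ f]) auto
  next
    case (insert x S)
    show ?case
    proof (cases "x \<in> S")
      case True
      then have "insert x S = S"
        by blast
      then show ?thesis
        using insert.IH by (simp only:)
    next
      case xnS: False
      show ?thesis
      proof (intro impI)
        assume xS: "insert x S \<subseteq> Z" and cl: "\<forall>v\<in>insert x S. nxt v \<in> insert x S \<union> Y"
        have less: "D (nxt v) < D v" if "v \<in> Z" "nxt v \<in> Z" for v
          using nxt[OF that(1)] that wt_pos[of v "nxt v"] by auto
        \<comment> \<open>The new vertex \<open>x\<close> has the largest \<open>D\<close>, so it is
          no successor of a vertex of \<open>S\<close>, and \<open>S\<close> is itself
          closed.\<close>
        have "nxt v \<noteq> x" if "v \<in> S" for v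
          using less[of v] insert.hyps(2)[OF that] xS that by force
        moreover have nx: "nxt x \<in> S \<union> Y"
          using less[of x] cl xS by force
        ultimately obtain f' where f': "f \<subseteq>\<^sub>m f'" "dom f' = dom f \<union> S"
          "\<forall>v\<in>S. \<exists>y\<in>Y. f' v = f y \<and> nr ((Z \<union> Y) \<inter> {x. f' x = f y}) (D v) v y"
          using insert.IH xS cl by blast
        have ff: "f' y = f y" if "y \<in> Y" for y
          using f'(1) YD that unfolding map_le_def by (metis subsetD)
        define n where "n = nxt x"
        have "x \<in> Z"
          using xS by simp
        then have n: "n \<in> dom f'" "(x, n) \<in> E" "n \<in> Z \<union> Y" "x \<in> Z"
          using nx YD nxt[of x] unfolding n_def f'(2) by blast+
        define g where "g = f'(x := f' n)"
        have x: "x \<notin> dom f'"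
          using xnS \<open>x \<in> Z\<close> ZD unfolding f'(2) by blast
        have le: "f' \<subseteq>\<^sub>m g"
          using x unfolding g_def map_le_def by simp
        have sub: "{z. f' z = f y} \<subseteq> {z. g z = f y}" if "y \<in> Y" for y
        proof
          fix z assume z: "z \<in> {z. f' z = f y}"
          have "f y \<noteq> None"
            using YD that by blast
          then have "z \<noteq> x"
            using x z by auto
          then show "z \<in> {z. g z = f y}"
            using z unfolding g_def by simp
        qed
        have 1: "\<exists>y\<in>Y. g v = f y \<and> nr ((Z \<union> Y) \<inter> {z. g z = f y}) (D v) v y" if vS: "v \<in> S" for v
        proof -
          obtain y where y: "y \<in> Y" "f' v = f y" "nr ((Z \<union> Y) \<inter> {x. f' x = f y}) (D v) v y"
            using f'(3) vS by blast
          have "v \<noteq> x"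
            using xnS vS by blast
          then have "g v = f y"
            using y(2) unfolding g_def by simp
          then show ?thesis
            using y(1) near_mono[OF y(3) Int_mono[OF subset_refl sub[OF y(1)]] order_refl] by blast
        qed
        have gn: "g x = g n"
          unfolding g_def by auto
        have 2: "\<exists>y\<in>Y. g x = f y \<and> nr ((Z \<union> Y) \<inter> {z. g z = f y}) (D x) x y"
        proof (cases "n \<in> Y")
          case True
          have "n \<noteq> x"
            using n(1) x by auto
          then have gnf: "g n = f n"
            using ff[OF True] unfolding g_def by simp
          have "nr ((Z \<union> Y) \<inter> {z. g z = f n}) (wt x n) x n"
            by (rule near_edge[OF n(2)]) (use n(3,4) gn gnf in simp_all)
          moreover have "wt x n \<le> D x"
            using nxt[OF n(4)] unfolding n_def by blast
          ultimately have "nr ((Z \<union> Y) \<inter> {z. g z = f n}) (D x) x n"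
            using near_mono by blast
          then show ?thesis
            using True gn gnf by auto
        next
          case False
          then have "n \<in> S"
            using nx n_def by auto
          then obtain y where y: "y \<in> Y" "g n = f y" "nr ((Z \<union> Y) \<inter> {z. g z = f y}) (D n) n y"
            using 1 by blast
          have "nr ((Z \<union> Y) \<inter> {z. g z = f y}) (wt x n) x n"
            by (rule near_edge[OF n(2)]) (use n(3,4) y(2) gn in simp_all)
          from near_trans[OF this y(3)]
          have "nr ((Z \<union> Y) \<inter> {z. g z = f y}) (wt x n + D n) x y" .
          moreover have "wt x n + D n \<le> D x"
            using nxt[OF n(4)] \<open>n \<in> S\<close> xS unfolding n_def by blast
          ultimately have "nr ((Z \<union> Y) \<inter> {z. g z = f y}) (D x) x y"
            using near_mono by blast
          then show ?thesis
            using y gn by auto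
        qed
        have "dom g = dom f \<union> insert x S"
          using n(1) f'(2) unfolding g_def by auto
        then show "\<exists>f'. f \<subseteq>\<^sub>m f' \<and> dom f' = dom f \<union> insert x S \<and>
            (\<forall>v\<in>insert x S. \<exists>y\<in>Y. f' v = f y \<and> nr ((Z \<union> Y) \<inter> {x. f' x = f y}) (D v) v y)"
          using 1 2 map_le_trans[OF f'(1) le] by (intro exI[of _ g]) simp
      qed
    qed
  qed
  from this[OF fin_Z] obtain f' where f': "f \<subseteq>\<^sub>m f'" "dom f' = dom f \<union> Z"
    "\<forall>v\<in>Z. \<exists>y\<in>Y. f' v = f y \<and> nr ((Z \<union> Y) \<inter> {x. f' x = f y}) (D v) v y"
    using nxt by blast
  have "\<exists>y\<in>Y. f' v = f y \<and> nr ((Z \<union> Y) \<inter> {x. f' x = f y}) d v y" if "v \<in> Z" for v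
    using f'(3) that P(2)[OF that] unfolding D_def by (meson near_mono order_refl)
  then show thesis
    using that f' by blast
qed

text \<open>A shortest path with its list structure forgotten: \<open>pos\<close> is arc length, the
  middle clause lets stretches of the path be used as vertex sets, and the last clause is minimality
  in \<open>S\<close>.\<close>

definition geodesic :: "nat set \<Rightarrow> nat set \<Rightarrow> (nat \<Rightarrow> real) \<Rightarrow> bool" where
  "geodesic S Pi pos \<longleftrightarrow> Pi \<subseteq> S \<and>
    (\<forall>u\<in>Pi. \<forall>v\<in>Pi. pos u \<le> pos v \<longrightarrow> nr {x \<in> Pi. pos u \<le> pos x \<and> pos x \<le> pos v} (pos v - pos u) u v) \<and>
    (\<forall>u\<in>Pi. \<forall>v\<in>Pi. \<forall>d. nr S d u v \<longrightarrow> \<bar>pos u - pos v\<bar> \<le> d)"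

text \<open>Prefix lengths serve as coordinates. Positive weights make their order the order along
  \<open>P\<close>, and a connection in \<open>S\<close> shorter than a coordinate difference could
  be spliced into \<open>P\<close>, against its minimality.\<close>

lemma shortest_path_geodesic:
  assumes P: "is_path E S P a b" and short: "\<And>Q. is_path E S Q a b \<Longrightarrow> plen wt P \<le> plen wt Q"
  obtains pos where "geodesic S (set P) pos"
proof -
  define pos where "pos v = plen wt (takeWhile (\<lambda>x. x \<noteq> v) P @ [v])" for v
  have pos: "pos v = plen wt (xs @ [v])" if "P = xs @ v # ys" for xs v ys
  proof -
    have "v \<notin> set xs"
      using is_pathD(2)[OF P] that by auto
    then have "takeWhile (\<lambda>x. x \<noteq> v) (xs @ v # ys) = xs"
      by (subst takeWhile_append2) auto
    then show ?thesis
      using that unfolding pos_def by simp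
  qed
  have order: "\<exists>xs ys zs. P = xs @ u # ys @ v # zs" if "u \<in> set P" "v \<in> set P" "pos u \<le> pos v" "u \<noteq> v" for u v
  proof -
    from \<open>u \<in> set P\<close> obtain xs ys where 1: "P = xs @ u # ys"
      by (meson split_list)
    show ?thesis
    proof (cases "v \<in> set ys")
      case True
      then obtain cs ds where "ys = cs @ v # ds"
        by (meson split_list)
      then show ?thesis using 1 by blast
    next
      case False
      then have "v \<in> set xs"
        using 1 that by auto
      then obtain as bs where 2: "xs = as @ v # bs"
        by (meson split_list)
      have "pos u = plen wt (as @ v # bs @ [u])"
        using pos[OF 1] 2 by simp
      also have "\<dots> = pos v + plen wt (v # bs @ [u])"
        using pos[of as v "bs @ u # ys"] 1 2 plen_split[of wt as v "bs @ [u]"] by simp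
      finally have "plen wt (v # bs @ [u]) \<le> 0"
        using that by simp
      moreover have w: "walk (v # bs @ [u])"
        using is_pathD(4)[OF P] unfolding 1 2 by (auto simp: successively_append_iff successively_Cons hd_append split: if_splits)
      ultimately show ?thesis
      proof (cases bs)
        case Nil
        then show ?thesis using w wt_pos[of v u] \<open>plen wt (v # bs @ [u]) \<le> 0\<close> by simp
      next
        case (Cons c cs)
        then show ?thesis
          using w wt_pos[of v c] \<open>plen wt (v # bs @ [u]) \<le> 0\<close> plen_nonneg[of "c # cs @ [u]"] by simp
      qed
    qed
  qed
  have seg: "pos v = pos u + plen wt (u # ys @ [v])" if "P = xs @ u # ys @ v # zs" for u v xs ys zs
    using pos[of xs u "ys @ v # zs"] pos[of "xs @ u # ys" v zs] that
      plen_split[of wt xs u "ys @ [v]"] by simp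
  have mono: "pos u \<le> pos v" if "P = xs @ u # ys @ v # zs" for u v xs ys zs
  proof -
    have "walk (u # ys @ [v])"
      using is_pathD(4)[OF P] unfolding that by (auto simp: successively_append_iff successively_Cons hd_append split: if_splits)
    then show ?thesis using seg[OF that] plen_nonneg by force
  qed
  have "nr {x \<in> set P. pos u \<le> pos x \<and> pos x \<le> pos v} (pos v - pos u) u v"
    if uv: "u \<in> set P" "v \<in> set P" "pos u \<le> pos v" for u v
  proof (cases "u = v")
    case False
    then obtain xs ys zs where 1: "P = xs @ u # ys @ v # zs"
      using order uv by blast
    have "x \<in> set P \<and> pos u \<le> pos x \<and> pos x \<le> pos v" if "x \<in> set ys" for x
    proof -
      obtain as bs where ys: "ys = as @ x # bs"
        using \<open>x \<in> set ys\<close> by (meson split_list)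
      show ?thesis
        using mono[of xs u as x "bs @ v # zs"] mono[of "xs @ u # as" x bs v zs] 1 ys by auto
    qed
    moreover have "walk (u # ys @ [v])"
      using is_pathD(4)[OF P] unfolding 1 by (auto simp: successively_append_iff successively_Cons hd_append split: if_splits)
    ultimately show ?thesis
      using near_walk[of "u # ys @ [v]" "{x \<in> set P. pos u \<le> pos x \<and> pos x \<le> pos v}" "pos v - pos u"]
        seg[OF 1] uv by auto
  qed (use uv in \<open>auto intro!: near_refl\<close>)
  moreover have le: "pos v - pos u \<le> d" if uv: "u \<in> set P" "v \<in> set P" "pos u \<le> pos v" "nr S d u v" for u v d
  proof (cases "u = v")
    case True
    then show ?thesis using near_nonneg[OF uv(4)] by simp
  next
    case False
    then obtain xs ys zs where 1: "P = xs @ u # ys @ v # zs"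
      using order uv by blast
    have w: "walk (xs @ [u])" "walk (v # zs)"
      using is_pathD(4)[OF P] unfolding 1 by (auto simp: successively_append_iff successively_Cons hd_append split: if_splits)
    have "nr S (pos u) a u"
      using near_walk[OF _ w(1), of S "pos u"] pos[OF 1] is_pathD(3,5)[OF P] 1 by (auto simp: hd_append)
    moreover have "nr S (plen wt (v # zs)) v b"
      using near_walk[OF _ w(2), of S] is_pathD(3,6)[OF P] 1 by (auto split: if_splits)
    ultimately have "nr S (pos u + d + plen wt (v # zs)) a b"
      using uv(4) near_trans by blast
    then have "plen wt P \<le> pos u + d + plen wt (v # zs)"
      unfolding near_def using short by (meson order_trans)
    moreover have "plen wt P = pos v + plen wt (v # zs)"
      using pos[of "xs @ u # ys" v zs] plen_split[of wt "xs @ u # ys" v zs] 1 by simp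
    ultimately show ?thesis by simp
  qed
  have "\<bar>pos u - pos v\<bar> \<le> d" if "u \<in> set P" "v \<in> set P" "nr S d u v" for u v d
    using le[of u v d] le[of v u d] near_sym that by (cases "pos u \<le> pos v") auto
  ultimately show thesis
    using that[of pos] is_pathD(3)[OF P] unfolding geodesic_def by blast
qed

end

section \<open>Growing the clusters\<close>


text \<open>Elements of F are pairs of a column and the vertex set of the subgraph in which its path is
  shortest. The path is kept as its vertex set and the position of each vertex along it.\<close>

locale column_system = weighted_graph +
  fixes w :: real and F :: "(nat set \<times> nat set) set"
    and Pi :: "nat set \<times> nat set \<Rightarrow> nat set" and pos :: "nat set \<times> nat set \<Rightarrow> nat \<Rightarrow> real"
  assumes w_pos: "w > 0" and finite_F: "finite F"
    and columns: "k \<in> F \<Longrightarrow> fst k \<noteq> {} \<and> fst k \<subseteq> snd k \<and> snd k \<subseteq> V"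
    and cover: "v \<in> V \<Longrightarrow> \<exists>k\<in>F. v \<in> fst k"
    and laminar: "k \<in> F \<Longrightarrow> m \<in> F \<Longrightarrow> k \<noteq> m \<Longrightarrow> snd k \<inter> snd m = {} \<or>
      (snd k \<subseteq> snd m \<and> fst m \<inter> snd k = {}) \<or> (snd m \<subseteq> snd k \<and> fst k \<inter> snd m = {})"
    and edges: "(u, v) \<in> E \<Longrightarrow> \<exists>k\<in>F. u \<in> snd k \<and> v \<in> snd k \<and> (u \<in> fst k \<or> v \<in> fst k)"
    and geod: "k \<in> F \<Longrightarrow> geodesic (snd k) (Pi k) (pos k)"
    and dominated: "k \<in> F \<Longrightarrow> x \<in> fst k \<Longrightarrow> \<exists>y\<in>Pi k \<inter> fst k. nr (fst k) (2 * w) x y"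
    and width: "0 \<le> B \<Longrightarrow> x \<in> V \<Longrightarrow>
      real (card {k \<in> F. \<exists>a\<in>fst k. nr (snd k) B a x}) \<le> (B / w + 2)\<^sup>2"
begin

lemma column_ancestor: "k \<in> F \<Longrightarrow> m \<in> F \<Longrightarrow> x \<in> fst k \<Longrightarrow> x \<in> snd m \<Longrightarrow> snd k \<subseteq> snd m"
  using laminar[of k m] columns[of k] by blast

text \<open>A tenth of \<open>w\<close>, because a chain of nine columns then spans at most
  \<open>9 / 10 * w\<close>, a distance at which \<open>width\<close> admits fewer than nine
  columns.\<close>

definition r :: real where "r = w / 10"

lemma r_pos: "r > 0" and r_w: "10 * r = w"
  using w_pos by (simp_all add: r_def)

definition cell :: "nat set \<times> nat set \<Rightarrow> nat \<Rightarrow> int" where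
  "cell k v = \<lfloor>pos k v / r\<rfloor>"

definition cls :: "(nat \<Rightarrow> 'l option) \<Rightarrow> 'l \<Rightarrow> nat set" where
  "cls f l = {v. f v = Some l}"

lemma cls_mono: "f \<subseteq>\<^sub>m f' \<Longrightarrow> cls f l \<subseteq> cls f' l"
  unfolding cls_def map_le_def by force

text \<open>The set A certifies that the path from v to its center was built by few absorptions: every
  absorption adds a new column to A and at most r to all distances.\<close>

definition linked ::
  "(nat set \<times> nat set) set \<Rightarrow> (nat \<Rightarrow> ((nat set \<times> nat set) \<times> nat) option) \<Rightarrow>
    nat \<Rightarrow> nat set \<times> nat set \<Rightarrow> nat \<Rightarrow> bool" where
  "linked D f v k p \<longleftrightarrow> (\<exists>A\<subseteq>D. card A \<le> 8 \<and> nr (cls f (k, p)) (card A * r) v p \<and>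
     (\<forall>m\<in>A. \<exists>a\<in>fst m. nr (snd m) (card A * r) a v))"

text \<open>A label is the pair of founding column and center. The final disjunction is the crux: a
  vertex attached in the last round of some column lies in that column, hence outside every later
  subgraph, and all vertices that can still be met by later columns satisfy the stronger
  \<open>linked\<close>.\<close>

definition placed ::
  "(nat set \<times> nat set) set \<Rightarrow> (nat \<Rightarrow> ((nat set \<times> nat set) \<times> nat) option) \<Rightarrow>
    nat \<Rightarrow> nat set \<times> nat set \<Rightarrow> nat \<Rightarrow> bool" where
  "placed D f v k p \<longleftrightarrow> k \<in> D \<and> v \<in> snd k \<and> p \<in> Pi k \<inter> fst k \<and> f p = Some (k, p) \<and>
     nr (cls f (k, p)) (3 * w) v p \<and> ((\<exists>m\<in>D. v \<in> fst m) \<or> linked D f v k p)"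

text \<open>The second clause, one cluster per cell of the founding column, serves the counting: it
  bounds how many clusters of one column come near a short path.\<close>

definition invariant ::
  "(nat set \<times> nat set) set \<Rightarrow> (nat \<Rightarrow> ((nat set \<times> nat set) \<times> nat) option) \<Rightarrow> bool" where
  "invariant D f \<longleftrightarrow> (\<forall>v k p. f v = Some (k, p) \<longrightarrow> placed D f v k p) \<and>
     (\<forall>k p p'. f p = Some (k, p) \<and> f p' = Some (k, p') \<and> cell k p = cell k p' \<longrightarrow> p = p') \<and>
     (\<forall>k\<in>D. fst k \<subseteq> dom f)"

lemma linked_mono: "linked D f v k p \<Longrightarrow> f \<subseteq>\<^sub>m f' \<Longrightarrow> D \<subseteq> D' \<Longrightarrow> linked D' f' v k p"
  unfolding linked_def using near_mono[OF _ cls_mono order_refl] by (meson order_trans)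

lemma map_le_SomeD: "f \<subseteq>\<^sub>m f' \<Longrightarrow> f v = Some l \<Longrightarrow> f' v = Some l"
  unfolding map_le_def by (metis domI)

lemma placed_mono: "placed D f v k p \<Longrightarrow> f \<subseteq>\<^sub>m f' \<Longrightarrow> D \<subseteq> D' \<Longrightarrow> placed D' f' v k p"
proof -
  assume *: "placed D f v k p" "f \<subseteq>\<^sub>m f'" "D \<subseteq> D'"
  have "nr (cls f' (k, p)) (3 * w) v p"
    using *(1) near_mono[OF _ cls_mono[OF *(2)] order_refl] unfolding placed_def by blast
  moreover have "f' p = Some (k, p)"
    using *(1) map_le_SomeD[OF *(2)] unfolding placed_def by blast
  moreover have "linked D f v k p \<Longrightarrow> linked D' f' v k p"
    using linked_mono *(2,3) by blast
  ultimately show ?thesis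
    using *(1,3) unfolding placed_def by blast
qed

lemma linked_near: "linked D f v k p \<Longrightarrow> nr (cls f (k, p)) w v p"
proof -
  assume "linked D f v k p"
  then obtain A where "A \<subseteq> D" "card A \<le> 8" "nr (cls f (k, p)) (card A * r) v p"
    unfolding linked_def by blast
  moreover have "card A * r \<le> w" if "card A \<le> 8" for A :: "(nat set \<times> nat set) set"
    using that mult_right_mono[of "real (card A)" 8 r] r_pos r_w by linarith
  ultimately show ?thesis
    using near_mono by blast
qed

text \<open>Labels grow in three rounds: \<open>f1\<close> absorbs, \<open>f2\<close> founds,
  \<open>f3\<close> attaches the rest of the column. Labelled vertices met in \<open>snd k\<close>
  are \<open>linked\<close>, hence within \<open>w\<close> of their centers, so the attachment over
  \<open>2 * w\<close> gives radius \<open>3 * w\<close>.\<close>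

lemma invariant_step:
  assumes inv: "invariant D f" and D: "D \<subseteq> F" and k: "k \<in> F" "k \<notin> D"
    and up: "\<And>m. m \<in> D \<Longrightarrow> snd m \<inter> snd k = {} \<or> (snd k \<subseteq> snd m \<and> fst m \<inter> snd k = {})"
  shows "\<exists>f'. invariant (insert k D) f'"
proof -
  let ?D = "insert k D"
  have fin_D: "finite D"
    using D finite_F finite_subset by blast
  define PE where "PE = Pi k \<inter> fst k"
  \<comment> \<open>The part of the path in cell \<open>g\<close>, trimmed to lie between vertices
    of the column. It may leave the column in between; vertices there receive labels before their
    own column is treated, and this is what makes absorption necessary.\<close>
  define I where "I g = {v \<in> Pi k. \<exists>y\<in>PE. \<exists>y'\<in>PE. cell k y = g \<and> cell k y' = g \<and>
     pos k y \<le> pos k v \<and> pos k v \<le> pos k y'}" for g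
  note G = geod[OF k(1), unfolded geodesic_def]
  have snd_k: "fst k \<subseteq> snd k" "snd k \<subseteq> V"
    using columns[OF k(1)] by auto
  have I_snd: "I g \<subseteq> snd k" for g
    using G unfolding I_def by blast
  have cell_I: "cell k v = g" if v: "v \<in> I g" for v g
  proof -
    obtain y y' where "cell k y = g" "cell k y' = g" "pos k y \<le> pos k v" "pos k v \<le> pos k y'"
      using v unfolding I_def by blast
    then show ?thesis
      unfolding cell_def using r_pos
      by (metis divide_right_mono floor_mono less_imp_le order_antisym)
  qed
  have near_I: "nr (I g) r u v" if uv: "u \<in> I g" "v \<in> I g" for u v g
  proof -
    have *: "nr (I g) r u v" if u: "u \<in> I g" and v: "v \<in> I g" and le: "pos k u \<le> pos k v" for u v
    proof -
      obtain y where y: "y \<in> PE" "cell k y = g" "pos k y \<le> pos k u"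
        using u unfolding I_def by blast
      obtain y' where y': "y' \<in> PE" "cell k y' = g" "pos k v \<le> pos k y'"
        using v unfolding I_def by blast
      have "{x \<in> Pi k. pos k u \<le> pos k x \<and> pos k x \<le> pos k v} \<subseteq> I g"
        using y y' unfolding I_def by force
      moreover have "pos k v / r - pos k u / r < 1"
        using cell_I[OF u] cell_I[OF v] unfolding cell_def by linarith
      then have "pos k v - pos k u \<le> r"
        using r_pos by (simp add: field_simps)
      moreover have "nr {x \<in> Pi k. pos k u \<le> pos k x \<and> pos k x \<le> pos k v} (pos k v - pos k u) u v"
        using G u v le unfolding I_def by blast
      ultimately show ?thesis
        using near_mono by blast
    qed
    show ?thesis
      using *[OF uv] *[OF uv(2,1)] near_sym by fastforce
  qed
  have PE_I: "y \<in> PE \<Longrightarrow> y \<in> I (cell k y)" for y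
    unfolding I_def PE_def by blast
  have I_PE: "\<exists>y\<in>PE. y \<in> I g" if v: "v \<in> I g" for v g
  proof -
    obtain y where "y \<in> PE" "cell k y = g"
      using v unfolding I_def by blast
    then show ?thesis using PE_I by blast
  qed
  define good where "good g \<longleftrightarrow> I g \<inter> dom f = {}" for g
  define Bad where "Bad = (\<Union>g\<in>{g. \<not> good g}. I g)"
  define Good where "Good = (\<Union>g\<in>{g. good g}. I g)"
  \<comment> \<open>All bad cells are absorbed at once, so that a single assignment settles which
    cluster takes which vertex.\<close>
  define Z where "Z = Bad - dom f"
  define Y where "Y = Bad \<inter> dom f"
  have ZY: "Z \<union> Y = Bad" "Bad \<subseteq> snd k"
    using I_snd unfolding Z_def Y_def Bad_def by blast+
  have "\<exists>y\<in>Y. nr (Z \<union> Y) r v y" if v: "v \<in> Z" for v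
  proof -
    obtain g where g: "v \<in> I g" "\<not> good g"
      using v unfolding Z_def Bad_def by blast
    then obtain y where y: "y \<in> I g" "y \<in> dom f"
      unfolding good_def by blast
    moreover have "I g \<subseteq> Bad"
      using g(2) unfolding Bad_def by blast
    ultimately show ?thesis
      using near_mono[OF near_I[OF g(1) y(1)] _ order_refl, of Bad] unfolding ZY(1) unfolding Y_def by blast
  qed
  moreover have "Z \<union> Y \<subseteq> V"
    using ZY snd_k by blast
  moreover have "Y \<subseteq> dom f" "Z \<inter> dom f = {}"
    unfolding Y_def Z_def by blast+
  ultimately obtain f1 where f1: "f \<subseteq>\<^sub>m f1" "dom f1 = dom f \<union> Z"
    "\<And>v. v \<in> Z \<Longrightarrow> \<exists>y\<in>Y. f1 v = f y \<and> nr ((Z \<union> Y) \<inter> {x. f1 x = f y}) r v y"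
    using voronoi_extension[of Z Y f r] by blast
  define ctr where "ctr g = (SOME y. y \<in> PE \<inter> I g)" for g
  have ctr: "ctr g \<in> PE" "ctr g \<in> I g" if v: "v \<in> I g" for v g
    using someI_ex[of "\<lambda>y. y \<in> PE \<inter> I g"] I_PE[OF v] unfolding ctr_def by blast+
  define f2 where "f2 = (\<lambda>v. if v \<in> Good then Some (k, ctr (cell k v)) else f1 v)"
  have Good_f1: "Good \<inter> dom f1 = {}"
    using cell_I unfolding f1(2) Good_def Z_def Bad_def good_def by blast
  have f12: "f1 \<subseteq>\<^sub>m f2"
    using Good_f1 unfolding map_le_def f2_def by auto
  have f02: "f \<subseteq>\<^sub>m f2"
    using map_le_trans[OF f1(1) f12] .
  have dom_f2: "dom f2 = dom f1 \<union> Good"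
    unfolding f2_def by (auto split: if_splits)
  have PE_f2: "PE \<subseteq> dom f2"
    using PE_I unfolding dom_f2 f1(2) Z_def Good_def Bad_def by blast
  \<comment> \<open>A labelled vertex of \<open>snd k\<close> lies in no column of \<open>D\<close>,
    as these avoid \<open>snd k\<close>; so \<open>placed\<close> can only hold through
    \<open>linked\<close>, and the subgraph of the founding column contains
    \<open>snd k\<close>.\<close>
  have old: "placed D f v k' p \<and> (v \<in> snd k \<longrightarrow> linked D f v k' p \<and> snd k \<subseteq> snd k')"
    if fv: "f v = Some (k', p)" for v k' p
  proof -
    have pl: "placed D f v k' p"
      using inv fv unfolding invariant_def by blast
    then have "linked D f v k' p \<and> snd k \<subseteq> snd k'" if v: "v \<in> snd k"
      using up v D columns unfolding placed_def by blast
    then show ?thesis using pl by blast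
  qed
  have new: "v \<in> snd k \<and> placed ?D f2 v k' p \<and> linked ?D f2 v k' p"
    if v: "v \<in> Z" and fv: "f2 v = Some (k', p)" for v k' p
  proof -
    obtain y where y: "y \<in> Y" "f1 v = f y" "nr ((Z \<union> Y) \<inter> {x. f1 x = f y}) r v y"
      using f1(3)[OF v] by blast
    have "v \<notin> Good"
      using v Good_f1 f1(2) by blast
    then have f1v: "f1 v = Some (k', p)"
      using fv unfolding f2_def by simp
    have fy: "f y = Some (k', p)"
      using f1v y(2) by simp
    have yk: "y \<in> snd k" and vk: "v \<in> snd k"
      using y(1) v ZY by blast+
    have pl: "placed D f y k' p" "linked D f y k' p" "snd k \<subseteq> snd k'"
      using old[OF fy] yk by blast+
    obtain A where A: "A \<subseteq> D" "card A \<le> 8" "nr (cls f (k', p)) (card A * r) y p"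
      "\<And>m. m \<in> A \<Longrightarrow> \<exists>a\<in>fst m. nr (snd m) (card A * r) a y"
      using pl(2) unfolding linked_def by blast
    \<comment> \<open>\<open>k\<close> is new, and its column comes within \<open>r\<close> of
      \<open>v\<close>. The bound for the columns of \<open>A\<close> grows by \<open>r\<close>,
      with paths still inside their own subgraphs because these contain
      \<open>snd k\<close>.\<close>
    define A' where "A' = insert k A"
    have cA: "real (card A') * r = r + real (card A) * r"
      using A(1) k(2) finite_subset[OF A(1) fin_D] unfolding A'_def by (subst card_insert_disjoint) (auto simp: algebra_simps)
    have "{x. f1 x = f y} \<subseteq> cls f2 (k', p)"
      using map_le_SomeD[OF f12] unfolding cls_def fy by blast
    then have "nr (cls f2 (k', p)) r v y"
      by (intro near_mono[OF y(3)]) auto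
    from near_trans[OF this near_mono[OF A(3) cls_mono[OF f02] order_refl]]
    have 1: "nr (cls f2 (k', p)) (card A' * r) v p"
      unfolding cA .
    have 2: "\<exists>a\<in>fst m. nr (snd m) (card A' * r) a v" if m: "m \<in> A'" for m
    proof (cases "m = k")
      case True
      obtain g where g: "v \<in> I g"
        using v unfolding Z_def Bad_def by blast
      then obtain a where a: "a \<in> PE" "a \<in> I g"
        using I_PE by blast
      have "r \<le> card A' * r"
        using r_pos unfolding cA by simp
      then have "nr (snd k) (card A' * r) a v"
        using near_mono[OF near_I[OF a(2) g] I_snd] by blast
      then show ?thesis
        using a(1) True unfolding PE_def by blast
    next
      case False
      then obtain a where a: "a \<in> fst m" "nr (snd m) (card A * r) a y" and mD: "m \<in> D"
        using m A(1,4) unfolding A'_def by blast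
      have "snd k \<subseteq> snd m"
        using up[OF mD] near_mem[OF a(2)] yk by blast
      then have "(Z \<union> Y) \<inter> {x. f1 x = f y} \<subseteq> snd m"
        using ZY by blast
      then have "nr (snd m) r y v"
        using near_mono[OF near_sym[OF y(3)] _ order_refl] by blast
      from near_trans[OF a(2) this] have "nr (snd m) (card A' * r) a v"
        unfolding cA by (simp only: add.commute)
      then show ?thesis
        using a(1) by blast
    qed
    \<comment> \<open>\<open>A'\<close> has at most nine elements, all within
      \<open>9 / 10 * w\<close> of \<open>v\<close>. At this distance \<open>width\<close> allows at
      most \<open>(29 / 10)^2 < 9\<close>, so the ninth cannot occur.\<close>
    have B: "real (card A') * r \<le> 9 / 10 * w"
      using A(2) mult_right_mono[of "real (card A)" 8 r] r_pos r_w unfolding cA by linarith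
    have "A' \<subseteq> {m \<in> F. \<exists>a\<in>fst m. nr (snd m) (card A' * r) a v}"
      using 2 A(1) D k(1) unfolding A'_def by blast
    moreover have "finite {m \<in> F. \<exists>a\<in>fst m. nr (snd m) (card A' * r) a v}"
      using finite_F by simp
    moreover have nonneg: "0 \<le> card A' * r"
      using r_pos by simp
    moreover have "v \<in> V"
      using vk snd_k by blast
    ultimately have "real (card A') \<le> (card A' * r / w + 2)\<^sup>2"
      using card_le_from_subset[OF _ _ width] by blast
    also have "card A' * r / w \<le> 9 / 10"
      using B w_pos by (simp add: field_simps)
    then have "(card A' * r / w + 2)\<^sup>2 \<le> (9 / 10 + 2)\<^sup>2"
      using nonneg w_pos by (intro power_mono) simp_all
    also have "\<dots> < 9"
      by (simp add: power2_eq_square)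
    finally have "card A' \<le> 8"
      by simp
    then have lnk: "linked ?D f2 v k' p"
    proof -
      assume "card A' \<le> 8"
      moreover have "A' \<subseteq> ?D"
        using A(1) unfolding A'_def by blast
      ultimately show ?thesis
        unfolding linked_def using 1 2 by blast
    qed
    moreover have "nr (cls f2 (k', p)) (3 * w) v p"
      using near_mono[OF linked_near[OF lnk] order_refl] w_pos by auto
    then have "placed ?D f2 v k' p"
      using pl(1,3) vk lnk map_le_SomeD[OF f02] unfolding placed_def by blast
    ultimately show ?thesis
      using vk by blast
  qed
  have fresh: "v \<in> snd k \<and> placed ?D f2 v k' p \<and> linked ?D f2 v k' p"
    if v: "v \<in> Good" and fv: "f2 v = Some (k', p)" for v k' p
  proof -
    obtain g where g: "good g" "v \<in> I g"
      using v unfolding Good_def by blast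
    have gc: "cell k u = g" "u \<in> Good" if "u \<in> I g" for u
      using cell_I that g(1) unfolding Good_def by blast+
    have kp: "k' = k" "p = ctr g"
      using fv v gc[OF g(2)] unfolding f2_def by auto
    have sub: "I g \<subseteq> cls f2 (k', p)"
      using gc unfolding cls_def f2_def kp by auto
    \<comment> \<open>A founded cell starts with the certificate \<open>{k}\<close>, since any two
      of its vertices are within \<open>r\<close> of each other.\<close>
    have "nr (cls f2 (k', p)) (real (card {k}) * r) v p"
      using near_mono[OF near_I[OF g(2) ctr(2)[OF g(2)]] sub] unfolding kp by simp
    moreover have "nr (snd k) (real (card {k}) * r) p v"
      using near_mono[OF near_I[OF ctr(2)[OF g(2)] g(2)] I_snd] unfolding kp by simp
    moreover have pk: "p \<in> PE"
      using ctr(1)[OF g(2)] unfolding kp .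
    ultimately have lnk: "linked ?D f2 v k' p"
      unfolding linked_def PE_def by (intro exI[of _ "{k}"]) auto
    moreover have vk: "v \<in> snd k"
      using I_snd g(2) by blast
    moreover have "f2 p = Some (k', p)"
      using sub ctr(2)[OF g(2)] unfolding cls_def kp by blast
    moreover have "nr (cls f2 (k', p)) (3 * w) v p"
      using near_mono[OF linked_near[OF lnk] order_refl] w_pos by auto
    ultimately show ?thesis
      using pk kp unfolding placed_def PE_def by blast
  qed
  have all2: "placed ?D f2 v k' p \<and> (v \<in> snd k \<longrightarrow> linked ?D f2 v k' p \<and> snd k \<subseteq> snd k')"
    if fv: "f2 v = Some (k', p)" for v k' p
  proof (cases "v \<in> dom f")
    case True
    then have "f v = Some (k', p)"
      using fv f02 unfolding map_le_def by metis
    from old[OF this] show ?thesis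
      using placed_mono[OF _ f02, of D _ _ _ ?D] linked_mono[OF _ f02, of D _ _ _ ?D] by blast
  next
    case False
    then have "v \<in> Z \<or> v \<in> Good"
      using fv dom_f2 f1(2) by blast
    then have *: "v \<in> snd k" "placed ?D f2 v k' p" "linked ?D f2 v k' p"
      using new fresh fv by blast+
    then have "snd k \<subseteq> snd k'"
      using up[of k'] unfolding placed_def by blast
    then show ?thesis using * by blast
  qed
  \<comment> \<open>All path vertices in the column have labels now, so \<open>dominated\<close>
    leads from each remaining vertex of the column to a labelled one without leaving the
    column.\<close>
  define Z3 where "Z3 = fst k - dom f2"
  define Y3 where "Y3 = fst k \<inter> dom f2"
  have ZY3: "Z3 \<union> Y3 = fst k"
    unfolding Z3_def Y3_def by blast
  have "\<exists>y\<in>Y3. nr (Z3 \<union> Y3) (2 * w) v y" if v: "v \<in> Z3" for v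
    using dominated[OF k(1), of v] v PE_f2 unfolding ZY3 unfolding Z3_def Y3_def PE_def by blast
  moreover have "Z3 \<union> Y3 \<subseteq> V"
    using ZY3 snd_k by blast
  moreover have "Y3 \<subseteq> dom f2" "Z3 \<inter> dom f2 = {}"
    unfolding Y3_def Z3_def by blast+
  ultimately obtain f3 where f3: "f2 \<subseteq>\<^sub>m f3" "dom f3 = dom f2 \<union> Z3"
    "\<And>v. v \<in> Z3 \<Longrightarrow> \<exists>y\<in>Y3. f3 v = f2 y \<and> nr ((Z3 \<union> Y3) \<inter> {x. f3 x = f2 y}) (2 * w) v y"
    using voronoi_extension[of Z3 Y3 f2 "2 * w"] by blast
  have all3: "placed ?D f3 v k' p \<and> (k', p) \<in> ran f2" if fv: "f3 v = Some (k', p)" for v k' p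
  proof (cases "v \<in> dom f2")
    case True
    then have "f2 v = Some (k', p)"
      using fv f3(1) unfolding map_le_def by metis
    then show ?thesis
      using all2 placed_mono[OF _ f3(1) order_refl] unfolding ran_def by blast
  next
    case False
    then have v: "v \<in> Z3" "v \<in> fst k"
      using fv f3(2) Z3_def by blast+
    then obtain y where y: "y \<in> Y3" "f3 v = f2 y" "nr ((Z3 \<union> Y3) \<inter> {x. f3 x = f2 y}) (2 * w) v y"
      using f3(3) by blast
    have fy: "f2 y = Some (k', p)"
      using fv y(2) by simp
    have "y \<in> snd k"
      using y(1) snd_k unfolding Y3_def by blast
    then have pl: "placed ?D f2 y k' p" "linked ?D f2 y k' p" "snd k \<subseteq> snd k'"
      using all2[OF fy] by blast+
    have "{x. f3 x = f2 y} = cls f3 (k', p)"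
      unfolding cls_def fy by blast
    then have "nr (cls f3 (k', p)) (2 * w) v y"
      using near_mono[OF y(3) _ order_refl, of "cls f3 (k', p)"] by blast
    moreover have "nr (cls f3 (k', p)) w y p"
      using near_mono[OF linked_near[OF pl(2)] cls_mono[OF f3(1)] order_refl] .
    ultimately have "nr (cls f3 (k', p)) (2 * w + w) v p"
      by (rule near_trans)
    then have "nr (cls f3 (k', p)) (3 * w) v p"
      by simp
    then have "placed ?D f3 v k' p"
      using pl v(2) snd_k map_le_SomeD[OF f3(1)] unfolding placed_def by blast
    then show ?thesis
      using fy unfolding ran_def by blast
  qed
  \<comment> \<open>After the second round a label is either old or has as center the chosen vertex
    of its cell, so each cell of \<open>k\<close> founds at most one cluster; the third round only
    copies labels.\<close>
  have ran2: "f p = Some (k', p) \<or> (k' = k \<and> p = ctr (cell k p))" if l: "(k', p) \<in> ran f2" for k' p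
  proof -
    obtain v where fv: "f2 v = Some (k', p)"
      using l unfolding ran_def by blast
    show ?thesis
    proof (cases "v \<in> Good")
      case True
      then obtain g where g: "good g" "v \<in> I g"
        unfolding Good_def by blast
      then have "k' = k" "p = ctr g"
        using fv True cell_I[OF g(2)] unfolding f2_def by auto
      then show ?thesis
        using cell_I[OF ctr(2)[OF g(2)]] by simp
    next
      case False
      then have f1v: "f1 v = Some (k', p)"
        using fv unfolding f2_def by simp
      have "\<exists>y. f y = Some (k', p)"
      proof (cases "v \<in> Z")
        case True
        then show ?thesis using f1(3)[OF True] f1v by metis
      next
        case False
        then have "v \<in> dom f"
          using f1v f1(2) by blast
        then show ?thesis
          using f1v f1(1) unfolding map_le_def by metis
      qed
      then show ?thesis
        using old unfolding placed_def by blast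
    qed
  qed
  have uniq: "p = p'"
    if "f3 p = Some (k', p)" "f3 p' = Some (k', p')" "cell k' p = cell k' p'" for k' p p'
  proof (cases "k' = k")
    case True
    have "f q \<noteq> Some (k, q)" for q
      using old k(2) unfolding placed_def by blast
    then show ?thesis
      using ran2[of k' p] ran2[of k' p'] all3 that unfolding True by metis
  next
    case False
    then have "f p = Some (k', p)" "f p' = Some (k', p')"
      using ran2 all3 that by blast+
    then show ?thesis
      using inv that(3) unfolding invariant_def by blast
  qed
  have "fst m \<subseteq> dom f3" if m: "m \<in> ?D" for m
  proof (cases "m = k")
    case True
    then show ?thesis
      using ZY3 unfolding f3(2) Y3_def by blast
  next
    case False
    then have "m \<in> D"
      using m by simp
    then have "fst m \<subseteq> dom f"
      using inv[unfolded invariant_def, THEN conjunct2, THEN conjunct2] by (rule_tac bspec)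
    then show ?thesis
      unfolding f3(2) dom_f2 f1(2) by blast
  qed
  then have "invariant ?D f3"
    unfolding invariant_def
  proof (intro conjI allI impI ballI)
    fix v k' p assume "f3 v = Some (k', p)"
    from all3[OF this] show "placed ?D f3 v k' p" ..
  next
    fix k' p p' assume "f3 p = Some (k', p) \<and> f3 p' = Some (k', p') \<and> cell k' p = cell k' p'"
    then show "p = p'"
      using uniq[of p k' p'] by simp
  qed simp
  then show ?thesis by blast
qed

text \<open>The induction takes away a column with smallest \<open>snd k\<close>. By laminarity each
  remaining subgraph is disjoint from \<open>snd k\<close>, or contains it and has its column
  outside it, as \<open>invariant_step\<close> asks of the earlier columns.\<close>

lemma ex_invariant: "\<exists>f. invariant F f"
proof -
  have *: "D \<subseteq> F \<longrightarrow> (\<exists>f. invariant D f)"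
    if "finite D" "\<And>k m. k \<in> D \<Longrightarrow> m \<in> F \<Longrightarrow> snd k \<subset> snd m \<Longrightarrow> m \<in> D" for D
    using that
  proof (induction "card D" arbitrary: D)
    case 0
    then have "D = {}" by simp
    then show ?case
      by (intro impI exI[of _ Map.empty]) (auto simp: invariant_def)
  next
    case (Suc n)
    show ?case
    proof
      assume D: "D \<subseteq> F"
      have "D \<noteq> {}"
        using Suc.hyps(2) by auto
      then have "Min ((\<lambda>k. card (snd k)) ` D) \<in> (\<lambda>k. card (snd k)) ` D"
        using Suc.prems(1) by (intro Min_in) simp_all
      then obtain k where k: "k \<in> D" and mink: "Min ((\<lambda>k. card (snd k)) ` D) = card (snd k)"
        by blast
      have min: "card (snd k) \<le> card (snd m)" if "m \<in> D" for m
        unfolding mink[symmetric] using Suc.prems(1) that by (intro Min_le) simp_all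
      let ?D = "D - {k}"
      have fin: "finite (snd m)" if "m \<in> F" for m
        using columns[OF that] finite_V finite_subset by blast
      have closed: "m \<in> ?D" if l: "l \<in> ?D" and m: "m \<in> F" and lm: "snd l \<subset> snd m" for l m
      proof -
        have "l \<in> D"
          using l by blast
        then have "m \<in> D" "card (snd k) \<le> card (snd l)"
          using Suc.prems(2)[OF _ m lm] min by simp_all
        moreover have "card (snd l) < card (snd m)"
          using psubset_card_mono[OF fin[OF m] lm] .
        ultimately have "m \<in> D" "m \<noteq> k"
          by auto
        then show ?thesis by simp
      qed
      have card: "n = card ?D" "finite ?D" "?D \<subseteq> F"
        using Suc.hyps(2) k Suc.prems(1) D by auto
      have "\<exists>f. invariant ?D f"
        by (rule Suc.hyps(1)[OF card(1,2) closed, THEN mp, OF _ _ _ card(3)])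
      then obtain f where f: "invariant ?D f" ..
      have up: "snd m \<inter> snd k = {} \<or> (snd k \<subseteq> snd m \<and> fst m \<inter> snd k = {})" if m: "m \<in> ?D" for m
      proof -
        have mk: "m \<in> F" "k \<in> F" "m \<noteq> k"
          using m D k by blast+
        have "\<not> (snd m \<subseteq> snd k \<and> fst k \<inter> snd m = {})"
        proof
          assume *: "snd m \<subseteq> snd k \<and> fst k \<inter> snd m = {}"
          then have "snd m \<subset> snd k"
            using columns[OF mk(2)] by blast
          then have "card (snd m) < card (snd k)"
            using psubset_card_mono[OF fin[OF mk(2)]] by blast
          then show False
            using min[of m] m by simp
        qed
        then show ?thesis
          using laminar[OF mk] by blast
      qed
      have "\<exists>f'. invariant (insert k ?D) f'"
        by (rule invariant_step[OF f card(3) _ _ up]) (use D k in auto)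
      then show "\<exists>f. invariant D f"
        using k by (simp add: insert_absorb)
    qed
  qed
  show ?thesis
    by (rule *[OF finite_F, THEN mp]) simp_all
qed

end

section \<open>Hop lengths\<close>


text \<open>5148 = 36 * 143: at most 36 columns contribute to the removed clusters, each at most 143 of them.\<close>

primrec hop_bound :: "nat \<Rightarrow> nat" where
  "hop_bound 0 = 0"
| "hop_bound (Suc n) = 5148 * (hop_bound n + 1) + hop_bound n"

context weighted_graph
begin

text \<open>Counts clusters rather than edges of the cluster graph, so that bounds simply add up
  under concatenation.\<close>

definition hops :: "(nat \<Rightarrow> nat set) \<Rightarrow> nat \<Rightarrow> nat list \<Rightarrow> bool" where
  "hops cl n P \<longleftrightarrow> (\<exists>cs. cs \<noteq> [] \<and> length cs \<le> n \<and> set cs \<subseteq> cl ` set P \<and>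
     successively (cadj E) cs \<and> hd cs = cl (hd P) \<and> last cs = cl (last P))"

lemma hops_mono: "hops cl n P \<Longrightarrow> n \<le> n' \<Longrightarrow> hops cl n' P"
  unfolding hops_def by (meson order_trans)

lemma hops_same: "P \<noteq> [] \<Longrightarrow> cl (hd P) = cl (last P) \<Longrightarrow> hops cl 1 P"
  unfolding hops_def by (intro exI[of _ "[cl (hd P)]"]) auto

lemma hops_append:
  assumes A: "hops cl n P" "P \<noteq> []" and B: "hops cl m Q" "Q \<noteq> []"
    and e: "(last P, hd Q) \<in> E" "last P \<in> cl (last P)" "hd Q \<in> cl (hd Q)"
  shows "hops cl (n + m) (P @ Q)"
proof -
  obtain cs where cs: "cs \<noteq> []" "length cs \<le> n" "set cs \<subseteq> cl ` set P" "successively (cadj E) cs"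
    "hd cs = cl (hd P)" "last cs = cl (last P)"
    using A(1) unfolding hops_def by blast
  obtain ds where ds: "ds \<noteq> []" "length ds \<le> m" "set ds \<subseteq> cl ` set Q" "successively (cadj E) ds"
    "hd ds = cl (hd Q)" "last ds = cl (last Q)"
    using B(1) unfolding hops_def by blast
  \<comment> \<open>\<open>cadj\<close> excludes equal clusters, so a cluster shared at the joint
    must be listed only once.\<close>
  define es where "es = (if cl (last P) = cl (hd Q) then cs @ tl ds else cs @ ds)"
  have ds': "ds = cl (hd Q) # tl ds"
    using ds(1,5) by (cases ds) auto
  have "es \<noteq> []" "length es \<le> n + m" "hd es = cl (hd (P @ Q))"
    using cs ds A(2) unfolding es_def by auto
  moreover have "set es \<subseteq> cl ` set (P @ Q)"
  proof -
    have "set (tl ds) \<subseteq> set ds"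
      using list.set_sel(2)[OF ds(1)] by blast
    then have "set es \<subseteq> set cs \<union> set ds"
      unfolding es_def by auto
    then show ?thesis
      using cs(3) ds(3) unfolding set_append image_Un by (meson Un_mono order_trans)
  qed
  moreover have "successively (cadj E) es"
  proof (cases "cl (last P) = cl (hd Q)")
    case True
    have "successively (cadj E) (cl (hd Q) # tl ds)"
      using ds(4) ds' by simp
    then show ?thesis
      using True cs unfolding es_def by (auto simp: successively_append_iff successively_Cons)
  next
    case False
    then have "cadj E (cl (last P)) (cl (hd Q))"
      using e unfolding cadj_def by blast
    then show ?thesis
      using False cs ds unfolding es_def by (auto simp: successively_append_iff)
  qed
  moreover have "last es = cl (last (P @ Q))"
  proof (cases "cl (last P) = cl (hd Q)")
    case True
    have "last (cl (hd Q) # tl ds) = cl (last Q)"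
      using ds(6) ds' by simp
    then show ?thesis
      using True cs B(2) unfolding es_def by (auto split: if_splits)
  next
    case False
    then show ?thesis
      using ds B(2) unfolding es_def by simp
  qed
  ultimately show ?thesis
    unfolding hops_def by blast
qed

text \<open>From the first visit to a cluster of L one may jump to its last visit.\<close>

lemma hops_remove:
  assumes "P \<noteq> []" "walk P" "\<And>x. x \<in> set P \<Longrightarrow> x \<in> cl x" "finite L" "card L \<le> M"
    and "\<And>as Q bs. P = as @ Q @ bs \<Longrightarrow> Q \<noteq> [] \<Longrightarrow> cl ` set Q \<inter> L = {} \<Longrightarrow> hops cl H Q"
  shows "hops cl (M * (H + 1) + H) P"
  using assms
\<comment> \<open>Each of the at most \<open>M\<close> clusters of \<open>L\<close> costs one, and
  the at most \<open>M + 1\<close> pieces around them cost \<open>H\<close> each.\<close>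
proof (induction M arbitrary: P L)
  case 0
  then show ?case
    using "0.prems"(6)[of "[]" P "[]"] by simp
next
  case (Suc M)
  show ?case
  proof (cases "cl ` set P \<inter> L = {}")
    case True
    then have "hops cl H P"
      using Suc.prems(6)[of "[]" P "[]"] Suc.prems(1) by simp
    then show ?thesis
      by (rule hops_mono) simp
  next
    case False
    then have "\<exists>x\<in>set P. cl x \<in> L"
      by blast
    then obtain Q1 x R where x: "P = Q1 @ x # R" "cl x \<in> L" "\<forall>y\<in>set Q1. cl y \<notin> L"
      using split_list_first_prop[of P "\<lambda>x. cl x \<in> L"] by blast
    have "\<exists>y\<in>set (x # R). cl y = cl x"
      by simp
    then obtain R0 y R' where y: "x # R = R0 @ y # R'" "cl y = cl x" "\<forall>z\<in>set R'. cl z \<noteq> cl x"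
      using split_list_last_prop[of "x # R" "\<lambda>y. cl y = cl x"] by blast
    define mid where "mid = R0 @ [y]"
    have P: "P = Q1 @ mid @ R'"
      using x(1) y(1) mid_def by simp
    have hdm: "hd mid = x"
      using y(1) unfolding mid_def by (cases R0) auto
    have mid: "mid \<noteq> []" "last mid = y" "hops cl 1 mid"
      using hops_same[of mid cl] hdm y(2) unfolding mid_def by auto
    have tail: "hops cl (1 + (M * (H + 1) + H)) (mid @ R')"
    proof (cases "R' = []")
      case True
      then show ?thesis using hops_mono[OF mid(3)] by simp
    next
      case False
      have "hops cl (M * (H + 1) + H) R'"
      proof (rule Suc.IH[where L = "L - {cl x}"])
        show "R' \<noteq> []" by fact
        show "walk R'"
          using Suc.prems(2) unfolding P by (simp add: successively_append_iff)
        show "z \<in> cl z" if "z \<in> set R'" for z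
          using Suc.prems(3) that unfolding P by simp
        show "finite (L - {cl x})" "card (L - {cl x}) \<le> M"
          using Suc.prems(4,5) x(2) by simp_all
        show "hops cl H Q" if Q: "R' = as @ Q @ bs" "Q \<noteq> []" "cl ` set Q \<inter> (L - {cl x}) = {}" for as Q bs
        proof (rule Suc.prems(6)[of "Q1 @ mid @ as" Q bs])
          have "cl x \<notin> cl ` set Q"
            using y(3) Q(1) by auto
          then show "cl ` set Q \<inter> L = {}"
            using Q(3) by blast
        qed (use Q P in simp_all)
      qed
      moreover have "(last mid, hd R') \<in> E"
        using Suc.prems(2) False mid(1) unfolding P by (auto simp: successively_append_iff)
      moreover have "last mid \<in> set P" "hd R' \<in> set P"
        using False mid(1) unfolding P by auto
      ultimately show ?thesis
        using hops_append[OF mid(3,1) _ False] Suc.prems(3) by simp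
    qed
    show ?thesis
    proof (cases "Q1 = []")
      case True
      then show ?thesis
        using hops_mono[OF tail] unfolding P by simp
    next
      case False
      have "hops cl H Q1"
        using Suc.prems(6)[of "[]" Q1 "mid @ R'"] False x(3) P by auto
      moreover have "(last Q1, hd (mid @ R')) \<in> E"
        using Suc.prems(2) False mid(1) unfolding P by (auto simp: successively_append_iff)
      moreover have "last Q1 \<in> set P" "hd (mid @ R') \<in> set P" "mid @ R' \<noteq> []"
        using False mid(1) unfolding P by auto
      ultimately have "hops cl (H + (1 + (M * (H + 1) + H))) (Q1 @ mid @ R')"
        using hops_append[OF _ False tail] Suc.prems(3) by simp
      then show ?thesis
        unfolding P by (rule hops_mono) simp
    qed
  qed
qed

text \<open>Greedy cutting: the longest prefix of length at most \<open>w\<close> costs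
  \<open>N\<close> and together with the next edge is longer than \<open>w\<close>, so the remainder
  has lost more than \<open>w\<close>. A single edge longer than \<open>w\<close> does no harm,
  since crossing it leads at most to an adjacent cluster.\<close>

lemma hops_long:
  assumes w: "w > 0" and short: "\<And>Q. Q \<noteq> [] \<Longrightarrow> walk Q \<Longrightarrow> set Q \<subseteq> V \<Longrightarrow> plen wt Q \<le> w \<Longrightarrow> hops cl N Q"
    and cl: "\<And>x. x \<in> V \<Longrightarrow> x \<in> cl x"
    and P: "P \<noteq> []" "walk P" "set P \<subseteq> V"
  shows "\<exists>n. hops cl n P \<and> real n \<le> N * (plen wt P / w + 1)"
  using P
proof (induction "length P" arbitrary: P rule: less_induct)
  case less
  show ?case
  proof (cases "plen wt P \<le> w")
    case True
    have "real N * 1 \<le> N * (plen wt P / w + 1)"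
      using plen_nonneg[OF less.prems(2)] w by (intro mult_left_mono) auto
    then show ?thesis
      using short[OF less.prems True] by auto
  next
    case False
    define i where "i = (LEAST i. plen wt (take (Suc i) P) > w)"
    have "plen wt (take (Suc (length P)) P) > w"
      using False by simp
    then have i: "plen wt (take (Suc i) P) > w"
      unfolding i_def by (rule LeastI)
    have least: "\<not> plen wt (take (Suc j) P) > w" if "j < i" for j
      using not_less_Least[OF that[unfolded i_def]] .
    have "plen wt (take (Suc 0) P) = 0"
      by (cases P) simp_all
    then have "i \<noteq> 0"
      using i w by (metis not_less_iff_gr_or_eq)
    then obtain j where j: "i = Suc j"
      by (cases i) auto
    have il: "i < length P"
    proof (rule ccontr)
      assume "\<not> i < length P"
      then have "take (Suc j) P = P"
        using j by simp
      then show False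
        using least[of j] j False by simp
    qed
    define A B where "A = take i P" and "B = drop i P"
    have AB: "P = A @ B" "A \<noteq> []" "B \<noteq> []"
      using il \<open>i \<noteq> 0\<close> less.prems(1) unfolding A_def B_def by auto
    have "hd B = P ! i"
      using il unfolding B_def by (simp add: hd_drop_conv_nth)
    then have "plen wt (A @ [hd B]) > w"
      using i il unfolding A_def by (simp add: take_Suc_conv_app_nth)
    moreover have "plen wt A \<le> w"
      using least[of j] unfolding A_def j by simp
    moreover have "plen wt P = plen wt (A @ [hd B]) + plen wt B"
      using plen_split[of wt A "hd B" "tl B"] AB by simp
    ultimately have *: "plen wt A \<le> w" "plen wt B \<le> plen wt P - w"
      by auto
    have wAB: "walk A" "walk B" "(last A, hd B) \<in> E" "set A \<subseteq> V" "set B \<subseteq> V"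
      using less.prems(2,3) AB by (auto simp: successively_append_iff)
    obtain n where n: "hops cl n B" "real n \<le> N * (plen wt B / w + 1)"
      using less.hyps[of B] AB wAB by fastforce
    have "last A \<in> V" "hd B \<in> V"
      using wAB AB last_in_set hd_in_set by blast+
    then have "hops cl (N + n) P"
      using hops_append[OF short[OF AB(2) wAB(1,4) *(1)] AB(2) n(1) AB(3) wAB(3)] cl AB(1) by simp
    moreover have "plen wt B / w \<le> plen wt P / w - 1"
      using *(2) w by (simp add: field_simps)
    then have "N * (plen wt B / w + 1) \<le> N * (plen wt P / w)"
      by (intro mult_left_mono) auto
    then have "real (N + n) \<le> N * (plen wt P / w + 1)"
      using n(2) by (simp add: algebra_simps)
    ultimately show ?thesis by blast
  qed
qed

lemma walk_leaves:
  "walk P \<Longrightarrow> x \<in> set P \<Longrightarrow> x \<in> S \<Longrightarrow> y \<in> set P \<Longrightarrow> y \<notin> S \<Longrightarrow>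
    \<exists>u\<in>set P. \<exists>v\<in>set P. (u, v) \<in> E \<and> u \<in> S \<and> v \<notin> S"
proof (induction P arbitrary: x y)
  case (Cons a P)
  then have ne: "P \<noteq> []"
    by auto
  then have e: "(a, hd P) \<in> E" "(hd P, a) \<in> E" "walk P" "hd P \<in> set P"
    using Cons.prems(1) E_sym by (auto simp: successively_Cons)
  show ?case
  proof (cases "hd P \<in> S \<longleftrightarrow> a \<in> S")
    case True
    then have "\<exists>x'\<in>set P. x' \<in> S" "\<exists>y'\<in>set P. y' \<notin> S"
      using Cons.prems e(4) by auto
    then obtain x' y' where "x' \<in> set P" "x' \<in> S" "y' \<in> set P" "y' \<notin> S"
      by blast
    from Cons.IH[OF e(3) this] show ?thesis
      by auto
  next
    case False
    then show ?thesis
      using e by (meson list.set_intros)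
  qed
qed simp

end

section \<open>Counting the clusters met by a short path, and the resulting clustering\<close>

context column_system
begin

text \<open>Among the columns met by \<open>P\<close>, one with largest \<open>snd j\<close> is
  taken. If \<open>P\<close> left \<open>snd j\<close>, the column that \<open>edges\<close>
  provides for the crossing edge would be met by \<open>P\<close> too and, by laminarity, have a
  strictly larger subgraph.\<close>

lemma top_column:
  assumes P: "P \<noteq> []" "walk P" "set P \<subseteq> V"
  obtains j where "j \<in> F" "set P \<subseteq> snd j" "set P \<inter> fst j \<noteq> {}"
proof -
  let ?J = "{j \<in> F. set P \<inter> fst j \<noteq> {}}"
  have "hd P \<in> set P"
    using P(1) by simp
  moreover from this obtain j0 where "j0 \<in> F" "hd P \<in> fst j0"
    using P(3) cover by blast
  ultimately have "?J \<noteq> {}"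
    by blast
  then have "Max ((\<lambda>j. card (snd j)) ` ?J) \<in> (\<lambda>j. card (snd j)) ` ?J"
    using finite_F by (intro Max_in) simp_all
  then obtain j where j: "j \<in> ?J" and mj: "Max ((\<lambda>j. card (snd j)) ` ?J) = card (snd j)"
    by blast
  have max: "card (snd k) \<le> card (snd j)" if "k \<in> ?J" for k
    unfolding mj[symmetric] using finite_F that by (intro Max_ge) simp_all
  have "set P \<subseteq> snd j"
  proof (rule ccontr)
    assume "\<not> set P \<subseteq> snd j"
    then obtain y where y: "y \<in> set P" "y \<notin> snd j"
      by blast
    obtain x where x: "x \<in> set P" "x \<in> snd j"
      using j columns[of j] by blast
    obtain u v where uv: "u \<in> set P" "v \<in> set P" "(u, v) \<in> E" "u \<in> snd j" "v \<notin> snd j"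
      using walk_leaves[OF P(2) x y] by blast
    obtain k where k: "k \<in> F" "u \<in> snd k" "v \<in> snd k" "u \<in> fst k \<or> v \<in> fst k"
      using edges[OF uv(3)] by blast
    have "k \<noteq> j"
      using k uv by blast
    then have "snd j \<subset> snd k"
      using laminar[OF k(1), of j] j k uv by blast
    moreover have "finite (snd k)"
      using columns[OF k(1)] finite_V finite_subset by blast
    ultimately have "card (snd j) < card (snd k)"
      using psubset_card_mono by blast
    moreover have "k \<in> ?J"
      using k uv by blast
    ultimately show False
      using max[of k] by simp
  qed
  then show thesis
    using that[of j] j by blast
qed

lemma invariantD:
  assumes "invariant F f"
  shows "f v = Some (k, p) \<Longrightarrow> k \<in> F \<and> v \<in> snd k \<and> p \<in> Pi k \<and> p \<in> fst k \<and> f p = Some (k, p) \<and>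
      nr (cls f (k, p)) (3 * w) v p"
    and "f p = Some (k, p) \<Longrightarrow> f p' = Some (k, p') \<Longrightarrow> cell k p = cell k p' \<Longrightarrow> p = p'"
    and "dom f = V"
proof -
  have 1: "f v = Some (k, p) \<Longrightarrow> placed F f v k p" for v k p
    using assms[unfolded invariant_def, THEN conjunct1, rule_format] .
  then show "f v = Some (k, p) \<Longrightarrow> k \<in> F \<and> v \<in> snd k \<and> p \<in> Pi k \<and> p \<in> fst k \<and> f p = Some (k, p) \<and>
      nr (cls f (k, p)) (3 * w) v p"
    unfolding placed_def by blast
  show "f p = Some (k, p) \<Longrightarrow> f p' = Some (k, p') \<Longrightarrow> cell k p = cell k p' \<Longrightarrow> p = p'"
    using assms[unfolded invariant_def, THEN conjunct2, THEN conjunct1, rule_format] by blast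
  have "v \<in> V" if fv: "f v = Some l" for v l
  proof -
    obtain k p where "l = (k, p)"
      by (cases l)
    then have "placed F f v k p"
      using 1 fv by simp
    then show ?thesis
      using columns unfolding placed_def by blast
  qed
  moreover have "v \<in> dom f" if v: "v \<in> V" for v
  proof -
    obtain k where "k \<in> F" "v \<in> fst k"
      using cover v by blast
    then show ?thesis
      using assms[unfolded invariant_def, THEN conjunct2, THEN conjunct2] by blast
  qed
  ultimately show "dom f = V"
    by blast
qed

text \<open>Two such centers are joined through \<open>P\<close> inside \<open>snd k\<close> by a
  path of length at most \<open>3 * w + w + 3 * w = 70 * r\<close>. As the path of the column is
  shortest there, the indices of their cells are close, and each cell founds at most one cluster.
  The bound is \<open>143 = 2 * 71 + 1\<close>.\<close>

lemma labels_per_column: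
  assumes inv: "invariant F f" and k: "k \<in> F" and P: "walk P" "set P \<subseteq> snd k" "plen wt P \<le> w"
  shows "finite {p. \<exists>v\<in>set P. f v = Some (k, p)} \<and> card {p. \<exists>v\<in>set P. f v = Some (k, p)} \<le> 143"
    (is "finite ?A \<and> card ?A \<le> 143")
proof (cases "?A = {}")
  case True
  then show ?thesis by simp
next
  case False
  then obtain p0 where p0: "p0 \<in> ?A"
    by blast
  have cls: "cls f (k, p) \<subseteq> snd k" for p
    using invariantD(1)[OF inv] unfolding cls_def by blast
  have mem: "f p = Some (k, p) \<and> p \<in> Pi k \<and> (\<exists>v\<in>set P. nr (snd k) (3 * w) v p)" if p: "p \<in> ?A" for p
    using p invariantD(1)[OF inv] near_mono[OF _ cls order_refl] by blast
  have "\<bar>cell k p - cell k p0\<bar> \<le> 71" if p: "p \<in> ?A" for p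
  proof -
    obtain v where v: "v \<in> set P" "nr (snd k) (3 * w) v p"
      using mem[OF p] by blast
    obtain v0 where v0: "v0 \<in> set P" "nr (snd k) (3 * w) v0 p0"
      using mem[OF p0] by blast
    have "nr (snd k) (3 * w + w + 3 * w) p p0"
      using near_trans[OF near_trans[OF near_sym[OF v(2)] near_on_walk[OF P(1) v(1) v0(1) P(2,3)]] v0(2)] .
    then have "\<bar>pos k p - pos k p0\<bar> \<le> 3 * w + w + 3 * w"
      using geod[OF k] mem[OF p] mem[OF p0] unfolding geodesic_def by blast
    then have "\<bar>pos k p - pos k p0\<bar> \<le> 70 * r"
      using r_w by simp
    then have "\<bar>pos k p / r - pos k p0 / r\<bar> \<le> 70"
      using r_pos by (simp add: field_simps abs_if split: if_splits)
    then show ?thesis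
      unfolding cell_def by linarith
  qed
  then have sub: "cell k ` ?A \<subseteq> {cell k p0 - 71 .. cell k p0 + 71}"
    by fastforce
  have inj: "inj_on (cell k) ?A"
  proof (rule inj_onI)
    fix p p' assume "p \<in> ?A" "p' \<in> ?A" "cell k p = cell k p'"
    then show "p = p'"
      using mem invariantD(2)[OF inv] by blast
  qed
  have "finite ?A"
    using finite_imageD[OF finite_subset[OF sub] inj] by simp
  moreover have "card ?A = card (cell k ` ?A)"
    using card_image[OF inj] by simp
  moreover have "card (cell k ` ?A) \<le> card {cell k p0 - 71 .. cell k p0 + 71}"
    using sub by (intro card_mono) simp_all
  ultimately show ?thesis
    by simp
qed

text \<open>A center lies in its founding column and within \<open>3 * w + w\<close> of
  \<open>x\<close>; the condition \<open>snd j \<subseteq> snd k\<close> keeps \<open>P\<close>, and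
  so this connection, inside \<open>snd k\<close>. Hence \<open>width\<close> applies with
  \<open>B = 4 * w\<close>.\<close>

lemma labels_above_column:
  assumes inv: "invariant F f" and j: "j \<in> F"
    and P: "walk P" "set P \<subseteq> snd j" "set P \<inter> fst j \<noteq> {}" "plen wt P \<le> w"
  defines "L \<equiv> {(k, p). snd j \<subseteq> snd k \<and> (\<exists>v\<in>set P. f v = Some (k, p))}"
  shows "finite L \<and> card L \<le> 5148"
proof -
  obtain x where x: "x \<in> set P" "x \<in> fst j"
    using P(3) by blast
  define K where "K = {k \<in> F. snd j \<subseteq> snd k \<and> (\<exists>a\<in>fst k. nr (snd k) (4 * w) a x)}"
  define A where "A k = {p. \<exists>v\<in>set P. f v = Some (k, p)}" for k
  have K: "finite K" "card K \<le> 36"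
  proof -
    have sub: "K \<subseteq> {k \<in> F. \<exists>a\<in>fst k. nr (snd k) (4 * w) a x}"
      unfolding K_def by blast
    show "finite K"
      using finite_F unfolding K_def by simp
    have "x \<in> V"
      using x columns[OF j] by blast
    then have "real (card K) \<le> (4 * w / w + 2)\<^sup>2"
      using card_le_from_subset[OF _ sub width] finite_F w_pos by simp
    then show "card K \<le> 36"
      using w_pos by simp
  qed
  have "k \<in> K \<and> p \<in> A k" if l: "(k, p) \<in> L" for k p
  proof -
    obtain v where v: "snd j \<subseteq> snd k" "v \<in> set P" "f v = Some (k, p)"
      using l unfolding L_def by blast
    note lab = invariantD(1)[OF inv v(3)]
    have "cls f (k, p) \<subseteq> snd k"
      using invariantD(1)[OF inv] unfolding cls_def by blast
    then have "nr (snd k) (3 * w) p v"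
      using near_mono[OF near_sym] lab by blast
    moreover have "nr (snd k) w v x"
      using near_on_walk[OF P(1) v(2) x(1) _ P(4)] v(1) P(2) by blast
    ultimately have "nr (snd k) (3 * w + w) p x"
      by (rule near_trans)
    then show ?thesis
      using lab v unfolding K_def A_def by auto
  qed
  then have sub: "L \<subseteq> Sigma K A"
    by auto
  have A: "finite (A k) \<and> card (A k) \<le> 143" if "k \<in> K" for k
    unfolding A_def using that P(2) labels_per_column[OF inv _ P(1) _ P(4)] unfolding K_def by blast
  have "card (Sigma K A) = (\<Sum>k\<in>K. card (A k))"
    using K A by (intro card_SigmaI) auto
  also have "\<dots> \<le> card K * 143"
    using A sum_bounded_above[of K "\<lambda>k. card (A k)" 143] by simp
  also have "\<dots> \<le> 5148"
    using K by simp
  finally have "card (Sigma K A) \<le> 5148" .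
  moreover have "finite (Sigma K A)"
    using K A by (intro finite_SigmaI) auto
  ultimately show ?thesis
    using sub card_mono finite_subset order_trans by metis
qed

text \<open>B collects the columns that were dealt with before P was cut out of a longer path.\<close>

lemma hops_short:
  assumes inv: "invariant F f"
  defines "cl \<equiv> \<lambda>v. {u. f u = f v}"
  shows "P \<noteq> [] \<Longrightarrow> walk P \<Longrightarrow> set P \<subseteq> V \<Longrightarrow> plen wt P \<le> w \<Longrightarrow> B \<subseteq> F \<Longrightarrow> card B + n = 9 \<Longrightarrow>
    (\<And>j x. j \<in> B \<Longrightarrow> x \<in> set P \<Longrightarrow> x \<notin> fst j \<and> (\<exists>a\<in>fst j. nr (snd j) w a x)) \<Longrightarrow>
    hops cl (hop_bound n) P"
proof (induction n arbitrary: P B)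
  case (0 P B)
  obtain j where j: "j \<in> F" "set P \<subseteq> snd j" "set P \<inter> fst j \<noteq> {}"
    by (rule top_column[OF "0.prems"(1-3)])
  then obtain x where x: "x \<in> set P" "x \<in> fst j"
    by blast
  have fin_B: "finite B"
    using "0.prems"(5) finite_F finite_subset by blast
  \<comment> \<open>Ten columns would be within \<open>w\<close> of \<open>x\<close>, but
    \<open>width\<close> allows only \<open>(1 + 2)^2 = 9\<close>; this is the origin of the 9 in
    the statement.\<close>
  have "j \<notin> B"
    using "0.prems"(7) x by blast
  then have "card (insert j B) = 10"
    using "0.prems"(6) fin_B by simp
  have "nr (snd j) w x x"
    using near_refl[of x "snd j" w] x j(2) w_pos by auto
  then have sub: "insert j B \<subseteq> {k \<in> F. \<exists>a\<in>fst k. nr (snd k) w a x}"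
    using "0.prems"(5,7) j(1) x by blast
  have "x \<in> V"
    using x "0.prems"(3) by blast
  then have "real (card (insert j B)) \<le> (w / w + 2)\<^sup>2"
    using card_le_from_subset[OF _ sub width] finite_F w_pos by simp
  then have False
    using \<open>card (insert j B) = 10\<close> w_pos by (simp add: power2_eq_square)
  then show ?case ..
next
  case (Suc n P B)
  obtain j where j: "j \<in> F" "set P \<subseteq> snd j" "set P \<inter> fst j \<noteq> {}"
    by (rule top_column[OF Suc.prems(1-3)])
  define L where "L = {(k, p). snd j \<subseteq> snd k \<and> (\<exists>v\<in>set P. f v = Some (k, p))}"
  define L' where "L' = (\<lambda>l. {u. f u = Some l}) ` L"
  have L: "finite L" "card L \<le> 5148"
    using labels_above_column[OF inv j(1) Suc.prems(2) j(2,3) Suc.prems(4)] unfolding L_def by blast+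
  then have L': "finite L'" "card L' \<le> 5148"
    using card_image_le[OF L(1), of "\<lambda>l. {u. f u = Some l}"] unfolding L'_def by simp_all
  have clx: "x \<in> cl x" for x
    unfolding cl_def by simp
  obtain x where x: "x \<in> set P" "x \<in> fst j"
    using j(3) by blast
  have fin_B: "finite B"
    using Suc.prems(5) finite_F finite_subset by blast
  have jB: "j \<notin> B"
    using Suc.prems(7) x by blast
  have "hops cl (5148 * (hop_bound n + 1) + hop_bound n) P"
  proof (rule hops_remove[OF Suc.prems(1,2) clx L'])
    fix as Q bs assume Q: "P = as @ Q @ bs" "Q \<noteq> []" "cl ` set Q \<inter> L' = {}"
    show "hops cl (hop_bound n) Q"
    proof (rule Suc.IH[where B = "insert j B"])
      show "Q \<noteq> []" by fact
      show "walk Q"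
        using Suc.prems(2) Q(1) by (simp add: successively_append_iff)
      show "set Q \<subseteq> V"
        using Suc.prems(3) Q(1) by simp
      show "plen wt Q \<le> w"
        using plen_infix_le[of as Q bs] Suc.prems(2,4) Q(1) by simp
      show "insert j B \<subseteq> F"
        using Suc.prems(5) j(1) by simp
      show "card (insert j B) + n = 9"
        using Suc.prems(6) jB fin_B by simp
    next
      fix i y assume i: "i \<in> insert j B" and y: "y \<in> set Q"
      then have yP: "y \<in> set P"
        using Q(1) by simp
      show "y \<notin> fst i \<and> (\<exists>a\<in>fst i. nr (snd i) w a y)"
      proof (cases "i = j")
        case False
        then show ?thesis
          using i yP Suc.prems(7) by blast
      next
        case True
        \<comment> \<open>A vertex of column \<open>j\<close> belongs to a cluster whose founding
          subgraph contains \<open>snd j\<close>, and \<open>Q\<close> avoids all such clusters that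
          meet \<open>P\<close>.\<close>
        have "y \<notin> fst j"
        proof
          assume yj: "y \<in> fst j"
          have "y \<in> dom f"
            using invariantD(3)[OF inv] yP Suc.prems(3) by blast
          then obtain k p where fy: "f y = Some (k, p)"
            by (metis domD surj_pair)
          have "k \<in> F" "y \<in> snd k"
            using invariantD(1)[OF inv fy] by simp_all
          then have "snd j \<subseteq> snd k"
            using column_ancestor[OF j(1) _ yj] by blast
          then have "(k, p) \<in> L"
            using fy yP unfolding L_def by blast
          then have "cl y \<in> L'"
            unfolding cl_def L'_def fy by blast
          then show False
            using Q(3) y by blast
        qed
        moreover have "nr (snd j) w x y"
          using near_on_walk[OF Suc.prems(2) x(1) yP j(2) Suc.prems(4)] .
        ultimately show ?thesis
          using x(2) True by blast
      qed
    qed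
  qed
  then show ?case
    by simp
qed

text \<open>Clusters are the fibres of the labelling; two vertices of a fibre are joined through its
  center, whence \<open>6 * w\<close>.\<close>

lemma ex_clustering:
  "\<exists>\<C>. clustering E V \<C> \<and> (\<forall>C\<in>\<C>. strong_diam_le E wt C (6 * w)) \<and>
     (\<forall>u v P. is_path E V P u v \<longrightarrow> real (path_cost E \<C> P u v) \<le> hop_bound 9 * (plen wt P / w + 1))"
proof -
  obtain f where inv: "invariant F f"
    using ex_invariant by blast
  define cl where "cl = (\<lambda>v. {u. f u = f v})"
  define \<C> where "\<C> = cl ` V"
  have near_cl: "nr (cl v) (6 * w) x y" if xy: "v \<in> V" "x \<in> cl v" "y \<in> cl v" for v x y
  proof -
    obtain k p where fv: "f v = Some (k, p)"
      using xy(1) invariantD(3)[OF inv] by fastforce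
    have c: "cls f (k, p) = cl v"
      unfolding cls_def cl_def fv ..
    have "f x = Some (k, p)" "f y = Some (k, p)"
      using xy fv unfolding cl_def by simp_all
    then have "nr (cl v) (3 * w) x p" "nr (cl v) (3 * w) y p"
      using invariantD(1)[OF inv] c by metis+
    from near_trans[OF this(1) near_sym[OF this(2)]] show ?thesis
      by simp
  qed
  have cl_V: "cl v \<subseteq> V" if "v \<in> V" for v
    using invariantD(3)[OF inv] that unfolding cl_def by (metis (mono_tags, lifting) domIff mem_Collect_eq subsetI)
  have cl_self: "v \<in> cl v" for v
    unfolding cl_def by simp
  have cl_eq: "cl u = cl v" if "u \<in> cl v" for u v
    using that unfolding cl_def by simp
  have "connected_in E C" if C: "C \<in> \<C>" for C
  proof -
    obtain v where v: "v \<in> V" "C = cl v"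
      using C unfolding \<C>_def by blast
    show ?thesis
      unfolding connected_in_def
    proof (intro conjI ballI)
      show "C \<noteq> {}"
        using v cl_self by blast
      fix x y assume "x \<in> C" "y \<in> C"
      then show "\<exists>xs. is_path E C xs x y"
        using near_cl[OF v(1)] unfolding v(2) near_def by blast
    qed
  qed
  moreover have "\<Union> \<C> = V"
    using cl_V cl_self unfolding \<C>_def by blast
  moreover have "pairwise disjnt \<C>"
  proof (rule pairwiseI)
    fix C D assume "C \<in> \<C>" "D \<in> \<C>" "C \<noteq> D"
    then show "disjnt C D"
      using cl_eq unfolding \<C>_def disjnt_def by blast
  qed
  ultimately have "clustering E V \<C>"
    unfolding clustering_def by blast
  moreover have "strong_diam_le E wt C (6 * w)" if C: "C \<in> \<C>" for C
  proof -
    obtain v where v: "v \<in> V" "C = cl v"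
      using C unfolding \<C>_def by blast
    show ?thesis
      unfolding strong_diam_le_def v(2) using dist_in_le[OF cl_V[OF v(1)]] near_cl[OF v(1)] by blast
  qed
  moreover have "real (path_cost E \<C> P u v) \<le> hop_bound 9 * (plen wt P / w + 1)"
    if P: "is_path E V P u v" for u v P
  proof -
    have cluster: "cluster_of \<C> x = cl x" if x: "x \<in> V" for x
      unfolding cluster_of_def
    proof (rule the_equality)
      show "cl x \<in> \<C> \<and> x \<in> cl x"
        using x cl_self unfolding \<C>_def by blast
      show "C = cl x" if C: "C \<in> \<C> \<and> x \<in> C" for C
        using C cl_eq unfolding \<C>_def by blast
    qed
    have short: "hops cl (hop_bound 9) Q" if "Q \<noteq> []" "walk Q" "set Q \<subseteq> V" "plen wt Q \<le> w" for Q
      using hops_short[OF inv that, of "{}" 9] unfolding cl_def by simp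
    obtain n where n: "hops cl n P" "real n \<le> hop_bound 9 * (plen wt P / w + 1)"
      using hops_long[OF w_pos short cl_self is_pathD(1,4,3)[OF P]] by blast
    obtain cs where cs: "cs \<noteq> []" "length cs \<le> n" "set cs \<subseteq> cl ` set P" "successively (cadj E) cs"
      "hd cs = cl (hd P)" "last cs = cl (last P)"
      using n(1) unfolding hops_def by blast
    have uv: "u \<in> V" "v \<in> V"
      using is_pathD[OF P] by blast+
    have "path_cost E \<C> P u v \<le> length cs - 1"
      unfolding path_cost_def
    proof (rule Least_le, intro exI conjI)
      show "length cs = Suc (length cs - 1)"
        using cs(1) by simp
      show "set cs \<subseteq> \<C>"
        using cs(3) is_pathD(3)[OF P] unfolding \<C>_def by blast
      show "\<forall>C\<in>set cs. C \<inter> set P \<noteq> {}"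
        using cs(3) cl_self by blast
      show "successively (cadj E) cs" by fact
      show "hd cs = cluster_of \<C> u"
        using cs(5) cluster[OF uv(1)] is_pathD(5)[OF P] by simp
      show "last cs = cluster_of \<C> v"
        using cs(6) cluster[OF uv(2)] is_pathD(6)[OF P] by simp
    qed
    then have "real (path_cost E \<C> P u v) \<le> n"
      using cs(2) by linarith
    then show ?thesis
      using n(2) by linarith
  qed
  ultimately show ?thesis
    by blast
qed

end

section \<open>Gridtrees\<close>


locale gridtree_on = weighted_graph +
  fixes w :: real and X N :: "nat set" and rt :: nat and par :: "nat \<Rightarrow> nat" and col lft :: "nat \<Rightarrow> nat set"
  assumes gridtree: "gridtree E wt w X N rt par col lft" and X_sub: "X \<subseteq> V"
begin

lemma gt:
  shows w_pos: "w > 0"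
    and root: "finite N" "rt \<in> N" "par rt = rt" "\<forall>i\<in>N - {rt}. par i \<in> N" "\<forall>i\<in>N. \<exists>n. (par ^^ n) i = rt"
    and col_ne: "\<forall>i\<in>N. col i \<noteq> {}"
    and col_col: "\<forall>i\<in>N. \<forall>j\<in>N. i \<noteq> j \<longrightarrow> col i \<inter> col j = {}"
    and lft_lft: "\<forall>i\<in>N - {rt}. \<forall>j\<in>N - {rt}. i \<noteq> j \<longrightarrow> lft i \<inter> lft j = {}"
    and col_lft: "\<forall>i\<in>N. \<forall>j\<in>N - {rt}. col i \<inter> lft j = {}"
    and union: "(\<Union>i\<in>N. col i) \<union> (\<Union>i\<in>N - {rt}. lft i) = X"
    and adj0: "\<forall>u v. (u, v) \<in> E \<longrightarrow> u \<in> X \<longrightarrow> v \<in> X \<longrightarrow>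
        (\<exists>i\<in>N. u \<in> col i \<and> v \<in> col i) \<or>
        (\<exists>i\<in>N - {rt}. u \<in> lft i \<and> v \<in> lft i) \<or>
        (\<exists>i\<in>N. \<exists>j\<in>N. u \<in> col i \<and> v \<in> col j \<and> ((i \<noteq> rt \<and> par i = j) \<or> (j \<noteq> rt \<and> par j = i))) \<or>
        (\<exists>i\<in>N. \<exists>j\<in>N - {rt}. u \<in> col i \<and> v \<in> lft j \<and> (j = i \<or> par j = i)) \<or>
        (\<exists>i\<in>N. \<exists>j\<in>N - {rt}. v \<in> col i \<and> u \<in> lft j \<and> (j = i \<or> par j = i))"
    and col_width: "\<forall>i\<in>N. \<forall>a\<in>col i. \<forall>a'. (a, a') \<in> E \<longrightarrow> a' \<in> above_verts X N par col lft i \<longrightarrow>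
        (\<forall>b\<in>below_verts N par col lft i. \<forall>P. is_path E X P a b \<longrightarrow> plen wt P \<ge> w)"
    and shortcut: "\<forall>i\<in>N. let S = (\<Union>j\<in>subtree N par i. col j) \<union> (\<Union>j\<in>subtree N par i - {rt}. lft j) in
        \<exists>\<pi> u v. is_path E S \<pi> u v \<and> (\<forall>P. is_path E S P u v \<longrightarrow> plen wt \<pi> \<le> plen wt P) \<and>
          (\<forall>x\<in>col i. \<exists>y\<in>set \<pi> \<inter> col i. \<exists>Q. is_path E (col i) Q x y \<and> plen wt Q \<le> 2 * w)"
  using gridtree unfolding gridtree_def by - (elim conjE, assumption)+

abbreviation "sub \<equiv> subtree N par"

text \<open>The vertex set of the subgraph of column \<open>i\<close> in the shortcut condition. As
  \<open>lft j\<close> sits on the edge from \<open>j\<close> to its parent, the index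
  \<open>j = i\<close> contributes the leftover set above the column, which \<open>below i\<close>
  leaves out.\<close>

definition dom_set :: "nat \<Rightarrow> nat set" where
  "dom_set i = (\<Union>j\<in>sub i. col j) \<union> (\<Union>j\<in>sub i - {rt}. lft j)"

abbreviation "below \<equiv> below_verts N par col lft"

section \<open>The order of the tree and the location of vertices in it\<close>

lemma sub_N: "j \<in> sub i \<Longrightarrow> j \<in> N"
  unfolding subtree_def by simp

lemma par_N: "i \<in> N \<Longrightarrow> par i \<in> N"
  using root by (cases "i = rt") auto

lemma pow_N: "i \<in> N \<Longrightarrow> (par ^^ n) i \<in> N"
  by (induction n) (simp_all add: par_N)

lemma sub_refl: "i \<in> N \<Longrightarrow> i \<in> sub i"
  unfolding subtree_def by (auto intro!: exI[of _ 0])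

lemma sub_trans: "j \<in> sub i \<Longrightarrow> k \<in> sub j \<Longrightarrow> k \<in> sub i"
proof -
  assume "j \<in> sub i" "k \<in> sub j"
  then obtain a b where "(par ^^ a) j = i" "(par ^^ b) k = j" "k \<in> N"
    unfolding subtree_def by blast
  then have "(par ^^ (a + b)) k = i"
    by (simp add: funpow_add)
  then show ?thesis
    using \<open>k \<in> N\<close> unfolding subtree_def by blast
qed

lemma root_pow: "(par ^^ n) rt = rt"
  by (induction n) (simp_all add: root)

text \<open>If \<open>par\<close> led from \<open>i\<close> back to \<open>i\<close> in a positive
  number of steps, its iterates would be periodic; yet they end in the root, a fixed point, so
  \<open>i\<close> is the root.\<close>

lemma sub_antisym:
  assumes "i \<in> sub j" "j \<in> sub i" shows "i = j"
proof -
  obtain a b where ab: "(par ^^ a) i = j" "(par ^^ b) j = i" and "i \<in> N"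
    using assms unfolding subtree_def by blast
  show ?thesis
  proof (cases "a = 0")
    case False
    have 1: "(par ^^ (b + a)) i = i"
      using ab by (simp add: funpow_add)
    have 2: "((par ^^ (b + a)) ^^ n) i = i" for n
      by (induction n) (simp_all add: 1)
    obtain m where m: "(par ^^ m) i = rt"
      using root(5) \<open>i \<in> N\<close> by blast
    have "(b + a) * m = ((b + a) * m - m) + m"
      using False by simp
    then have "(par ^^ ((b + a) * m)) i = (par ^^ ((b + a) * m - m)) ((par ^^ m) i)"
      by (metis comp_apply funpow_add)
    then have "i = rt"
      using 2[of m] m root_pow by (simp add: funpow_mult)
    then show ?thesis
      using ab(1) root_pow by simp
  qed (use ab in simp)
qed

lemma sub_linear:
  assumes "k \<in> sub i" "k \<in> sub j" shows "i \<in> sub j \<or> j \<in> sub i"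
proof -
  have *: "i \<in> sub j" if "(par ^^ a) k = i" "(par ^^ b) k = j" "a \<le> b" "k \<in> N" for a b i j
  proof -
    have "(par ^^ (b - a)) i = (par ^^ ((b - a) + a)) k"
      using that(1) by (simp only: funpow_add comp_apply)
    then have "(par ^^ (b - a)) i = j"
      using that by simp
    then show ?thesis
      using pow_N[OF that(4), of a] that(1) unfolding subtree_def by blast
  qed
  obtain a b where "(par ^^ a) k = i" "(par ^^ b) k = j" "k \<in> N"
    using assms unfolding subtree_def by blast
  then show ?thesis
    using * by (meson nat_le_linear)
qed

lemma sub_par: "j \<in> N \<Longrightarrow> j \<in> sub (par j)"
  unfolding subtree_def by (auto intro!: exI[of _ 1])

lemma par_sub: "k \<in> sub i \<Longrightarrow> k \<noteq> i \<Longrightarrow> par k \<in> sub i"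
proof -
  assume "k \<in> sub i" "k \<noteq> i"
  then obtain n where n: "(par ^^ n) k = i" "k \<in> N"
    unfolding subtree_def by blast
  then obtain m where "n = Suc m"
    using \<open>k \<noteq> i\<close> by (cases n) auto
  then have "(par ^^ m) (par k) = i"
    using n by (simp add: funpow_swap1)
  then show ?thesis
    using par_N[OF n(2)] unfolding subtree_def by blast
qed

lemma root_sub: "rt \<in> sub i \<Longrightarrow> i = rt"
  using root_pow unfolding subtree_def by auto

lemma col_X: "i \<in> N \<Longrightarrow> col i \<subseteq> X" and lft_X: "j \<in> N - {rt} \<Longrightarrow> lft j \<subseteq> X"
  using union by blast+

lemma col_unique: "v \<in> col i \<Longrightarrow> v \<in> col j \<Longrightarrow> i \<in> N \<Longrightarrow> j \<in> N \<Longrightarrow> i = j"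
  using col_col by blast

lemma lft_unique: "v \<in> lft i \<Longrightarrow> v \<in> lft j \<Longrightarrow> i \<in> N - {rt} \<Longrightarrow> j \<in> N - {rt} \<Longrightarrow> i = j"
  using lft_lft by blast

lemma col_not_lft: "v \<in> col i \<Longrightarrow> i \<in> N \<Longrightarrow> j \<in> N - {rt} \<Longrightarrow> v \<notin> lft j"
  using col_lft by blast

lemma col_dom: "v \<in> col j \<Longrightarrow> j \<in> N \<Longrightarrow> v \<in> dom_set i \<longleftrightarrow> j \<in> sub i"
  unfolding dom_set_def using col_unique col_not_lft sub_N by blast

lemma lft_dom: "v \<in> lft j \<Longrightarrow> j \<in> N - {rt} \<Longrightarrow> v \<in> dom_set i \<longleftrightarrow> j \<in> sub i"
  unfolding dom_set_def using lft_unique col_not_lft sub_N by blast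

lemma node_of: "v \<in> X \<Longrightarrow> \<exists>j\<in>N. v \<in> col j \<or> (j \<noteq> rt \<and> v \<in> lft j)"
  using union by blast

lemma below_iff: "v \<in> below i \<longleftrightarrow> (\<exists>j\<in>sub i. j \<noteq> i \<and> (v \<in> col j \<or> (j \<noteq> rt \<and> v \<in> lft j)))"
  unfolding below_verts_def using root_sub by blast

lemma dom_X: "dom_set i \<subseteq> X"
  unfolding dom_set_def using col_X lft_X sub_N by blast

lemma dom_mono: "i \<in> sub j \<Longrightarrow> dom_set i \<subseteq> dom_set j"
  unfolding dom_set_def using sub_trans by blast

lemma dom_node: "v \<in> dom_set i \<Longrightarrow> \<exists>j\<in>sub i. v \<in> col j \<or> (j \<noteq> rt \<and> v \<in> lft j)"
  unfolding dom_set_def by blast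

lemma dom_linear:
  assumes "v \<in> dom_set i" "v \<in> dom_set j" shows "i \<in> sub j \<or> j \<in> sub i"
proof -
  obtain k where k: "k \<in> sub i" "v \<in> col k \<or> (k \<noteq> rt \<and> v \<in> lft k)"
    using dom_node[OF assms(1)] by blast
  then have "k \<in> sub j"
    using assms(2) col_dom lft_dom sub_N by blast
  then show ?thesis
    using sub_linear k(1) by blast
qed

lemma dom_below: "m \<in> sub i \<Longrightarrow> m \<noteq> i \<Longrightarrow> dom_set m \<subseteq> below i"
proof
  fix v assume m: "m \<in> sub i" "m \<noteq> i" and v: "v \<in> dom_set m"
  obtain k where k: "k \<in> sub m" "v \<in> col k \<or> (k \<noteq> rt \<and> v \<in> lft k)"
    using dom_node[OF v] by blast
  have "k \<noteq> i"
    using sub_antisym m k(1) by blast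
  then show "v \<in> below i"
    using sub_trans[OF m(1) k(1)] k(2) below_iff by blast
qed

lemma adj:
  assumes "(u, v) \<in> E" "u \<in> X" "v \<in> X"
  obtains (col) i where "i \<in> N" "u \<in> col i" "v \<in> col i"
    | (lft) i where "i \<in> N - {rt}" "u \<in> lft i" "v \<in> lft i"
    | (child) i where "i \<in> N" "u \<in> col i" "v \<in> col (par i)"
    | (parent) j where "j \<in> N" "u \<in> col (par j)" "v \<in> col j"
    | (down) i j where "i \<in> N" "j \<in> N - {rt}" "u \<in> col i" "v \<in> lft j" "j = i \<or> par j = i"
    | (up) i j where "i \<in> N" "j \<in> N - {rt}" "v \<in> col i" "u \<in> lft j" "j = i \<or> par j = i"
  using adj0[rule_format, OF assms] by blast

text \<open>Column \<open>i\<close> separates what is below it from the rest: by column adjacency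
  the ends of an edge sit at equal or neighbouring places of the tree, and every place next to
  \<open>below i\<close> is in \<open>below i\<close> or is the column itself.\<close>

lemma enter_below:
  assumes e: "(u, v) \<in> E" "u \<in> X" "i \<in> N" "u \<notin> col i \<union> below i" and v: "v \<in> below i"
  shows False
proof -
  obtain j where j: "j \<in> sub i" "j \<noteq> i" "v \<in> col j \<or> (j \<noteq> rt \<and> v \<in> lft j)"
    using v below_iff by blast
  have jN: "j \<in> N"
    using sub_N j(1) .
  then have vX: "v \<in> X"
    using j(3) col_X[OF jN] lft_X[of j] jN by auto
  have u_col: "u \<notin> col k" if "k \<in> sub i" for k
    using e(4) that below_iff[of u i] by (cases "k = i") auto
  have u_lft: "u \<notin> lft k" if "k \<in> sub i" "k \<noteq> i" "k \<noteq> rt" for k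
    using e(4) that below_iff[of u i] by auto
  have pj: "par j \<in> sub i"
    using par_sub j by blast
  from e(1,2) vX show False
  proof (cases rule: adj)
    case (col k)
    then show False
      using j col_unique[of v k j] col_not_lft[of v k j] jN u_col by blast
  next
    case (lft k)
    then show False
      using j lft_unique[of v k j] col_not_lft[of v j k] jN u_lft by blast
  next
    case (child k)
    then have "par k = j"
      using j col_unique[of v "par k" j] col_not_lft[of v "par k" j] jN par_N by blast
    then have "k \<in> sub i"
      using sub_trans[OF j(1)] sub_par[OF child(1)] by simp
    then show False
      using u_col child(2) by blast
  next
    case (parent k)
    then have "k = j"
      using j col_unique[of v k j] col_not_lft[of v k j] jN by blast
    then show False
      using u_col[OF pj] parent(2) by simp
  next
    case (down k l)
    then have "l = j"
      using j lft_unique[of v l j] col_not_lft[of v j l] jN by blast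
    then show False
      using u_col[OF pj] u_col[OF j(1)] down(3,5) by blast
  next
    case (up k l)
    then have kj: "k = j"
      using j col_unique[of v k j] col_not_lft[of v k j] jN by blast
    have lk: "l \<in> sub j"
      using up(2,5) kj sub_refl sub_par by blast
    then have "l \<in> sub i"
      using sub_trans[OF j(1)] by blast
    moreover have "l \<noteq> i"
      using sub_antisym lk j(1,2) by blast
    ultimately show False
      using u_lft up(2,4) by blast
  qed
qed

text \<open>The nodes with \<open>x\<close> in their \<open>dom_set\<close> are those on the way
  from the node holding \<open>x\<close> to the root, hence form a chain.\<close>

lemma chain_top:
  assumes "finite A" "A \<noteq> {}" "\<And>m. m \<in> A \<Longrightarrow> m \<in> N \<and> x \<in> dom_set m"
  shows "\<exists>m\<in>A. A \<subseteq> sub m"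
  using assms
proof (induction A rule: finite_ne_induct)
  case (singleton a)
  then show ?case using sub_refl by blast
next
  case (insert a A)
  then obtain m where m: "m \<in> A" "A \<subseteq> sub m"
    by blast
  have "x \<in> dom_set a" "x \<in> dom_set m" "a \<in> N"
    using insert.prems m(1) by blast+
  then consider "a \<in> sub m" | "m \<in> sub a"
    using dom_linear by blast
  then show ?case
  proof cases
    case 1
    then show ?thesis using m by blast
  next
    case 2
    then have "A \<subseteq> sub a"
      using m(2) sub_trans by blast
    then show ?thesis
      using sub_refl[OF \<open>a \<in> N\<close>] by blast
  qed
qed

text \<open>The last step into the column comes from a vertex above it. This supplies the neighbour
  that the column width condition requires of its starting vertex.\<close>

lemma enter_column:
  assumes m: "m \<in> N" "x \<in> below m" and Q: "is_path E X Q a x" "a \<notin> col m \<union> below m"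
  obtains xs b zs b' where "Q = xs @ b # zs" "b \<in> col m" "(b, b') \<in> E" "b' \<in> X - (col m \<union> below m)"
proof -
  have "x \<in> col m \<union> below m"
    using m(2) by blast
  then obtain xs y z zs where *: "Q = xs @ y # z # zs" "y \<notin> col m \<union> below m" "set (z # zs) \<subseteq> col m \<union> below m"
    "(y, z) \<in> E" "y \<in> X" "z \<in> X"
    using last_entry[OF Q(1) Q(2)] by blast
  have "z \<notin> below m"
    using enter_below[OF *(4,5) m(1) *(2)] by blast
  then have "z \<in> col m"
    using *(3) by auto
  then show thesis
    using that[of "xs @ [y]" z zs y] * E_sym by auto
qed

text \<open>The path passes the columns of \<open>A\<close> from the top down. From a vertex of
  column \<open>j\<close> with a neighbour above, reaching the topmost \<open>m\<close> costs
  \<open>w\<close>, and the vertex where \<open>m\<close> is last entered has a neighbour above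
  again. When one column of \<open>A\<close> is left, reaching \<open>x\<close> itself costs
  \<open>w\<close>.\<close>

lemma descent_length:
  assumes "card A = n" "finite A" "A \<subseteq> sub j - {j}" "\<And>m. m \<in> A \<Longrightarrow> x \<in> dom_set m"
    "is_path E X Q a x" "a \<in> col j" "(a, a') \<in> E" "a' \<in> X - (col j \<union> below j)" "j \<in> N"
  shows "real n * w \<le> plen wt Q"
  using assms
proof (induction n arbitrary: A j Q a a')
  case 0
  then show ?case
    using plen_nonneg[OF is_pathD(4)] by simp
next
  case (Suc n)
  have AN: "m \<in> N" if "m \<in> A" for m
    using Suc.prems(3) that sub_N by blast
  have "A \<noteq> {}"
    using Suc.prems(1) by auto
  then obtain m where m: "m \<in> A" "A \<subseteq> sub m"
    using chain_top[OF Suc.prems(2)] AN Suc.prems(4) by blast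
  have above: "a' \<in> above_verts X N par col lft j"
    using Suc.prems(8) unfolding above_verts_def by blast
  have crossing: "w \<le> plen wt P" if "is_path E X P a b" "b \<in> below j" for P b
    using col_width Suc.prems(6,7,9) above that by blast
  have mj: "m \<in> sub j" "m \<noteq> j"
    using m(1) Suc.prems(3) by blast+
  show ?case
  proof (cases "n = 0")
    case True
    have "x \<in> below j"
      using dom_below[OF mj] Suc.prems(4)[OF m(1)] by blast
    then show ?thesis
      using crossing[OF Suc.prems(5)] True by simp
  next
    case False
    have card: "card (A - {m}) = n"
      using Suc.prems(1,2) m(1) by simp
    then obtain m' where m': "m' \<in> A - {m}"
      using False by (metis card.empty ex_in_conv)
    have "x \<in> below m"
      using dom_below[of m' m] m' m(2) Suc.prems(4) by blast
    moreover have "a \<notin> col m \<union> below m"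
    proof
      assume "a \<in> col m \<union> below m"
      then obtain k where k: "k \<in> sub m" "a \<in> col k \<or> (k \<noteq> rt \<and> a \<in> lft k)"
        using below_iff sub_refl[OF AN[OF m(1)]] by blast
      then have "k = j"
        using Suc.prems(6,9) col_unique col_not_lft sub_N by blast
      then show False
        using k(1) mj sub_antisym by blast
    qed
    ultimately obtain xs b zs b' where b: "Q = xs @ b # zs" "b \<in> col m" "(b, b') \<in> E"
      "b' \<in> X - (col m \<union> below m)"
      using enter_column[OF AN[OF m(1)] _ Suc.prems(5)] by blast
    have "is_path E X (xs @ [b]) a b"
      using is_path_prefix Suc.prems(5) unfolding b(1) .
    moreover have "b \<in> below j"
      using b(2) mj below_iff by blast
    ultimately have 1: "w \<le> plen wt (xs @ [b])"
      using crossing by blast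
    have "is_path E X (b # zs) b x"
      using is_path_suffix Suc.prems(5) is_pathD(3)[OF Suc.prems(5)] unfolding b(1) by auto
    then have 2: "real n * w \<le> plen wt (b # zs)"
      using Suc.IH[OF card _ _ _ _ b(2,3,4) AN[OF m(1)]] Suc.prems(2,4) m(2) by blast
    have "plen wt Q = plen wt (xs @ [b]) + plen wt (b # zs)"
      unfolding b(1) by (rule plen_split)
    then show ?thesis
      using 1 2 by (simp add: algebra_simps)
  qed
qed

text \<open>Two columns escape the count of \<open>descent_length\<close>: the topmost one
  \<open>i\<close>, where the path starts, and the next one \<open>j\<close>, where a neighbour
  above is first guaranteed. All others lie below \<open>j\<close> and cost \<open>w\<close>
  each.\<close>

lemma tree_width:
  assumes B: "0 \<le> B"
  shows "real (card {i \<in> N. \<exists>a\<in>col i. nr (dom_set i) B a x}) \<le> B / w + 2"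
proof -
  define A where "A = {i \<in> N. \<exists>a\<in>col i. nr (dom_set i) B a x}"
  have fin: "finite A"
    using root(1) unfolding A_def by simp
  have A: "m \<in> N \<and> x \<in> dom_set m" if "m \<in> A" for m
    using that near_mem unfolding A_def by blast
  show ?thesis
  proof (cases "card A \<le> 2")
    case True
    then have "real (card A) \<le> 2"
      by simp
    moreover have "0 \<le> B / w"
      using B w_pos by simp
    ultimately show ?thesis
      unfolding A_def by linarith
  next
    case False
    then have "A \<noteq> {}"
      by auto
    then obtain i where i: "i \<in> A" "A \<subseteq> sub i"
      using chain_top[OF fin] A by blast
    have c1: "card (A - {i}) = card A - 1"
      using fin i(1) by simp
    have "A - {i} \<noteq> {}"
    proof
      assume "A - {i} = {}"
      then have "card A - 1 = 0"
        using c1 by (metis card.empty)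
      then show False
        using False by simp
    qed
    then obtain j where j: "j \<in> A - {i}" "A - {i} \<subseteq> sub j"
      using chain_top[of "A - {i}"] fin A by blast
    define A2 where "A2 = A - {i} - {j}"
    have c2: "card A2 = card A - 2"
      using fin i(1) j(1) unfolding A2_def by simp
    then have "A2 \<noteq> {}"
      using False by auto
    then obtain k where k: "k \<in> A2"
      by blast
    have x: "x \<in> below j"
      using dom_below[of k j] k j(2) A unfolding A2_def by blast
    obtain a Q where a: "a \<in> col i" and Q: "is_path E (dom_set i) Q a x" "plen wt Q \<le> B"
      using i(1) unfolding A_def near_def by blast
    have QX: "is_path E X Q a x"
      using Q(1) dom_X unfolding is_path_def by blast
    have ij: "j \<in> sub i" "j \<noteq> i" "i \<in> N" "j \<in> N"
      using i j A by blast+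
    have "a \<notin> col j \<union> below j"
    proof
      assume "a \<in> col j \<union> below j"
      then obtain k where k: "k \<in> sub j" "a \<in> col k \<or> (k \<noteq> rt \<and> a \<in> lft k)"
        using below_iff sub_refl[OF ij(4)] by blast
      then have "k = i"
        using a ij(3) col_unique col_not_lft sub_N by blast
      then show False
        using k(1) ij sub_antisym by blast
    qed
    then obtain xs b zs b' where b: "Q = xs @ b # zs" "b \<in> col j" "(b, b') \<in> E"
      "b' \<in> X - (col j \<union> below j)"
      using enter_column[OF ij(4) x QX] by blast
    have A2: "finite A2" "A2 \<subseteq> sub j - {j}"
      using fin j(2) unfolding A2_def by auto
    have "x \<in> dom_set m" if "m \<in> A2" for m
      using A that unfolding A2_def by simp
    moreover have "is_path E X (b # zs) b x"
      using is_path_suffix[of E X xs b zs a x X] QX is_pathD(3)[OF QX] unfolding b(1) by simp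
    ultimately have "real (card A2) * w \<le> plen wt (b # zs)"
      by (rule descent_length[OF refl A2 _ _ b(2,3,4) ij(4)])
    also have "\<dots> \<le> plen wt Q"
      using plen_infix_le[of xs "b # zs" "[]"] is_pathD(4)[OF QX] unfolding b(1) by simp
    finally have "real (card A2) * w \<le> B"
      using Q(2) by simp
    then have "real (card A2) \<le> B / w"
      using w_pos by (simp add: field_simps)
    moreover have "real (card A) = real (card A2) + 2"
      using c2 False by simp
    ultimately show ?thesis
      unfolding A_def by linarith
  qed
qed

end

section \<open>From hierarchies to column families\<close>


context weighted_graph
begin

lemma component_subset:
  assumes K: "component E S K" and K': "component E S K'" and z: "z \<in> K" "z \<in> K'"
  shows "K \<subseteq> K'"
proof (rule ccontr)
  assume "\<not> K \<subseteq> K'"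
  then obtain x where x: "x \<in> K" "x \<notin> K'"
    by blast
  have "connected_in E K" "K \<subseteq> S"
    using K unfolding component_def by blast+
  then obtain P where P: "is_path E K P z x"
    using z(1) x(1) unfolding connected_in_def by blast
  obtain u v where uv: "u \<in> set P" "v \<in> set P" "(u, v) \<in> E" "u \<in> K'" "v \<notin> K'"
    using walk_leaves[OF is_pathD(4,7)[OF P] z(2) is_pathD(8)[OF P] x(2)] by blast
  have "v \<in> S - K'"
    using uv(2,5) is_pathD(3)[OF P] \<open>K \<subseteq> S\<close> by blast
  then show False
    using K' uv(3,4) unfolding component_def by blast
qed

lemma component_ex:
  assumes x: "x \<in> S"
  shows "\<exists>K. component E S K \<and> x \<in> K"
proof -
  define K where "K = {y. \<exists>d. nr S d x y}"
  have KS: "K \<subseteq> S"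
    unfolding K_def using near_mem by blast
  have xK: "x \<in> K"
    unfolding K_def using near_refl[OF x order_refl] by blast
  have inK: "\<exists>d. nr K d x y" if y: "y \<in> K" for y
  proof -
    obtain d P where P: "is_path E S P x y"
      using y unfolding K_def near_def by blast
    have "set P \<subseteq> K"
    proof
      fix z assume "z \<in> set P"
      then have "nr S (plen wt P) x z"
        using near_on_walk[OF is_pathD(4,7)[OF P] _ is_pathD(3)[OF P] order_refl] by blast
      then show "z \<in> K"
        unfolding K_def by blast
    qed
    then have "nr K (plen wt P) x y"
      using near_on_walk[OF is_pathD(4,7,8)[OF P] _ order_refl] by blast
    then show ?thesis ..
  qed
  have "connected_in E K"
    unfolding connected_in_def
  proof (intro conjI ballI)
    show "K \<noteq> {}"
      using xK by blast
    fix u v assume "u \<in> K" "v \<in> K"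
    then obtain d e where "nr K d x u" "nr K e x v"
      using inK by blast
    from near_trans[OF near_sym[OF this(1)] this(2)] show "\<exists>P. is_path E K P u v"
      unfolding near_def by blast
  qed
  moreover have "(y, z) \<notin> E" if yz: "y \<in> K" "z \<in> S - K" for y z
  proof
    assume e: "(y, z) \<in> E"
    obtain d where "nr S d x y"
      using yz(1) unfolding K_def by blast
    from near_trans[OF this near_edge[OF e]] have "\<exists>d. nr S d x z"
      using yz KS by blast
    then show False
      using yz(2) unfolding K_def by blast
  qed
  ultimately show ?thesis
    using KS xK unfolding component_def by blast
qed

text \<open>The structural assumptions of \<open>column_system\<close>, as a predicate that the
  induction over \<open>hier\<close> can carry for the graph of every node.\<close>

definition column_family :: "real \<Rightarrow> nat set \<Rightarrow> (nat set \<times> nat set) set \<Rightarrow> bool" where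
  "column_family w X F \<longleftrightarrow> finite F \<and>
     (\<forall>k\<in>F. fst k \<noteq> {} \<and> fst k \<subseteq> snd k \<and> snd k \<subseteq> X) \<and>
     (\<forall>v\<in>X. \<exists>k\<in>F. v \<in> fst k) \<and>
     (\<forall>k\<in>F. \<forall>m\<in>F. k \<noteq> m \<longrightarrow> snd k \<inter> snd m = {} \<or>
        (snd k \<subseteq> snd m \<and> fst m \<inter> snd k = {}) \<or> (snd m \<subseteq> snd k \<and> fst k \<inter> snd m = {})) \<and>
     (\<forall>u\<in>X. \<forall>v\<in>X. (u, v) \<in> E \<longrightarrow> (\<exists>k\<in>F. u \<in> snd k \<and> v \<in> snd k \<and> (u \<in> fst k \<or> v \<in> fst k))) \<and>
     (\<forall>k\<in>F. \<exists>Pi pos. geodesic (snd k) Pi pos \<and> (\<forall>x\<in>fst k. \<exists>y\<in>Pi \<inter> fst k. nr (fst k) (2 * w) x y))"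

definition close_columns :: "(nat set \<times> nat set) set \<Rightarrow> real \<Rightarrow> nat \<Rightarrow> (nat set \<times> nat set) set" where
  "close_columns F B x = {k \<in> F. \<exists>a\<in>fst k. nr (snd k) B a x}"

definition few_close :: "real \<Rightarrow> nat set \<Rightarrow> (nat set \<times> nat set) set \<Rightarrow> bool" where
  "few_close w X F \<longleftrightarrow> (\<forall>B x. 0 \<le> B \<longrightarrow> x \<in> X \<longrightarrow> real (card (close_columns F B x)) \<le> (B / w + 2)\<^sup>2)"

text \<open>The strengthening that makes the induction work. From an outer vertex \<open>v\<close>,
  each further layer uses up \<open>w\<close> of the distance \<open>B'\<close>, so at most
  \<open>B' / w + 1\<close> layers matter, whatever the depth of the hierarchy, and each contributes
  at most \<open>B / w + 2\<close> columns.\<close>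

definition few_close_from ::
  "real \<Rightarrow> nat set \<Rightarrow> nat set \<Rightarrow> (nat set \<times> nat set) set \<Rightarrow> bool" where
  "few_close_from w X C F \<longleftrightarrow> (\<forall>B B' x v. 0 \<le> B \<longrightarrow> v \<in> X \<longrightarrow> (\<exists>c\<in>C. (v, c) \<in> E) \<longrightarrow> nr X B' v x \<longrightarrow>
     real (card (close_columns F B x)) \<le> (B / w + 2) * (B' / w + 1))"

lemma close_columns_mem: "k \<in> close_columns F B x \<Longrightarrow> k \<in> F \<and> x \<in> snd k"
  unfolding close_columns_def using near_mem by blast

lemma close_columns_empty: "(\<And>k. k \<in> F \<Longrightarrow> x \<notin> snd k) \<Longrightarrow> close_columns F B x = {}"
  using close_columns_mem[of _ F B x] by blast

lemma close_columns_Un: "close_columns (F \<union> G) B x = close_columns F B x \<union> close_columns G B x"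
  unfolding close_columns_def by blast

end

section \<open>One gridtree combined with the families of its leftover components\<close>

locale layered_gridtree = gridtree_on +
  fixes C :: "nat set" and Fk :: "nat set \<Rightarrow> (nat set \<times> nat set) set"
  assumes layer_width: "\<And>u v c. u \<in> X \<Longrightarrow> v \<in> X \<Longrightarrow> c \<in> C \<Longrightarrow> (v, c) \<in> E \<Longrightarrow> nr X w u v \<Longrightarrow> u \<in> (\<Union>i\<in>N. col i)"
    and family: "\<And>j K. j \<in> N - {rt} \<Longrightarrow> component E (lft j) K \<Longrightarrow> column_family w K (Fk K)"
    and few: "\<And>j K. j \<in> N - {rt} \<Longrightarrow> component E (lft j) K \<Longrightarrow> few_close w K (Fk K)"
    and few_from: "\<And>j K. j \<in> N - {rt} \<Longrightarrow> component E (lft j) K \<Longrightarrow>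
      few_close_from w K (\<Union>i\<in>N. col i) (Fk K)"
begin

definition comps :: "nat set set" where
  "comps = {K. \<exists>j\<in>N - {rt}. component E (lft j) K}"

definition tree_cols :: "(nat set \<times> nat set) set" where
  "tree_cols = (\<lambda>i. (col i, dom_set i)) ` N"

definition all_cols :: "(nat set \<times> nat set) set" where
  "all_cols = tree_cols \<union> (\<Union>K\<in>comps. Fk K)"

lemma compsE:
  assumes "K \<in> comps"
  obtains j where "j \<in> N - {rt}" "component E (lft j) K" "K \<subseteq> lft j" "K \<subseteq> X" "K \<noteq> {}"
  using assms lft_X unfolding comps_def component_def connected_in_def by blast

lemma comps_disjoint: "K \<in> comps \<Longrightarrow> K' \<in> comps \<Longrightarrow> K \<noteq> K' \<Longrightarrow> K \<inter> K' = {}"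
proof (rule ccontr)
  assume K: "K \<in> comps" "K' \<in> comps" "K \<noteq> K'" "K \<inter> K' \<noteq> {}"
  obtain i where i: "i \<in> N - {rt}" "component E (lft i) K" "K \<subseteq> lft i"
    using compsE[OF K(1)] by metis
  obtain j where j: "j \<in> N - {rt}" "component E (lft j) K'" "K' \<subseteq> lft j"
    using compsE[OF K(2)] by metis
  obtain z where z: "z \<in> K" "z \<in> K'"
    using K(4) by blast
  have "i = j"
    using lft_unique[of z i j] z i j by blast
  then show False
    using component_subset[OF i(2) _ z] component_subset[OF _ i(2) z(2,1)] j(2) K(3) by blast
qed

lemma comps_cover: "v \<in> X \<Longrightarrow> (\<exists>i\<in>N. v \<in> col i) \<or> (\<exists>K\<in>comps. v \<in> K)"
proof -
  assume "v \<in> X"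
  then obtain j where j: "j \<in> N" "v \<in> col j \<or> (j \<noteq> rt \<and> v \<in> lft j)"
    using node_of by blast
  then show ?thesis
    using component_ex[of v "lft j"] unfolding comps_def by blast
qed

lemma comps_not_col: "K \<in> comps \<Longrightarrow> v \<in> K \<Longrightarrow> i \<in> N \<Longrightarrow> v \<notin> col i"
  using compsE col_not_lft by (metis subsetD)

text \<open>Neither different components of one leftover set nor different leftover sets are
  adjacent, so a component can be left only into a column. Every vertex through which it is entered
  is therefore an outer vertex.\<close>

lemma comps_edge:
  assumes K: "K \<in> comps" "z \<in> K" and y: "(y, z) \<in> E" "y \<in> X" "y \<notin> K"
  shows "y \<in> (\<Union>i\<in>N. col i)"
proof (rule ccontr)
  assume "y \<notin> (\<Union>i\<in>N. col i)"
  then have ny: "y \<notin> col i" if "i \<in> N" for i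
    using that by blast
  obtain j where j: "j \<in> N - {rt}" "component E (lft j) K" "K \<subseteq> lft j" "K \<subseteq> X"
    using compsE[OF K(1)] by metis
  have zX: "z \<in> X" and nz: "\<And>i. i \<in> N \<Longrightarrow> z \<notin> col i"
    using j(4) K comps_not_col by blast+
  from y(1,2) zX show False
  proof (cases rule: adj)
    case (lft i)
    then have "y \<in> lft j"
      using lft_unique[of z i j] j(1,3) K(2) by blast
    then show False
      using j(2) K(2) y(3) E_sym[OF y(1)] unfolding component_def by blast
  next
    case (col i)
    then show False using nz by blast
  next
    case (child i)
    then show False using nz[OF par_N[OF child(1)]] by blast
  next
    case (parent i)
    then show False using nz by blast
  next
    case (down i k)
    then show False using ny by blast
  next
    case (up i k)
    then show False using nz by blast
  qed
qed

lemma comps_family: "K \<in> comps \<Longrightarrow> column_family w K (Fk K)"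
  and comps_few: "K \<in> comps \<Longrightarrow> few_close w K (Fk K)"
  and comps_few_from: "K \<in> comps \<Longrightarrow> few_close_from w K (\<Union>i\<in>N. col i) (Fk K)"
  using family few few_from compsE by metis+

lemma comps_snd: "K \<in> comps \<Longrightarrow> k \<in> Fk K \<Longrightarrow> fst k \<noteq> {} \<and> fst k \<subseteq> snd k \<and> snd k \<subseteq> K"
  using comps_family[of K, unfolded column_family_def, THEN conjunct2, THEN conjunct1] by (metis bspec)

lemma finite_comps: "finite comps"
proof -
  have "K \<subseteq> V" if "K \<in> comps" for K
    using compsE[OF that] X_sub by (metis order_trans)
  then have "comps \<subseteq> Pow V"
    by blast
  then show ?thesis
    using finite_V finite_subset by blast
qed

lemma dom_set_comp: "K \<in> comps \<Longrightarrow> K \<subseteq> dom_set i \<or> K \<inter> dom_set i = {}"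
proof -
  assume "K \<in> comps"
  then obtain j where j: "j \<in> N - {rt}" "K \<subseteq> lft j"
    by (rule compsE)
  then have "v \<in> dom_set i \<longleftrightarrow> j \<in> sub i" if "v \<in> K" for v
    using lft_dom[of v j i] that by blast
  then show ?thesis
    by blast
qed

lemma col_dom_set: "i \<in> N \<Longrightarrow> col i \<subseteq> dom_set i"
  using sub_refl[of i] unfolding dom_set_def by blast

lemma tree_laminar:
  assumes ij: "i \<in> N" "j \<in> N" "i \<noteq> j"
  shows "dom_set i \<inter> dom_set j = {} \<or>
    (dom_set i \<subseteq> dom_set j \<and> col j \<inter> dom_set i = {}) \<or> (dom_set j \<subseteq> dom_set i \<and> col i \<inter> dom_set j = {})"
proof (cases "dom_set i \<inter> dom_set j = {}")
  case False
  have *: "dom_set i \<subseteq> dom_set j \<and> col j \<inter> dom_set i = {}" if s: "i \<in> sub j" and N: "j \<in> N" "i \<noteq> j" for i j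
  proof -
    have "j \<notin> sub i"
      using sub_antisym[OF s] N(2) by blast
    then have "v \<notin> dom_set i" if "v \<in> col j" for v
      using col_dom[OF that N(1)] by simp
    then show ?thesis
      using dom_mono[OF s] by blast
  qed
  obtain v where "v \<in> dom_set i" "v \<in> dom_set j"
    using False by blast
  then have "i \<in> sub j \<or> j \<in> sub i"
    by (rule dom_linear)
  then show ?thesis
    using *[of i j] *[of j i] ij by metis
qed simp

lemma all_laminar:
  assumes k: "k \<in> all_cols" and m: "m \<in> all_cols" and km: "k \<noteq> m"
  shows "snd k \<inter> snd m = {} \<or>
    (snd k \<subseteq> snd m \<and> fst m \<inter> snd k = {}) \<or> (snd m \<subseteq> snd k \<and> fst k \<inter> snd m = {})"
proof -
  have mixed: "snd k \<inter> snd m = {} \<or> (snd k \<subseteq> snd m \<and> fst m \<inter> snd k = {})"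
    if k: "k \<in> Fk K" "K \<in> comps" and m: "m \<in> tree_cols" for k m K
  proof -
    obtain i where i: "i \<in> N" "m = (col i, dom_set i)"
      using m unfolding tree_cols_def by blast
    have sk: "snd k \<subseteq> K"
      using comps_snd k by blast
    have "col i \<inter> K = {}"
      using comps_not_col[OF k(2) _ i(1)] by blast
    then show ?thesis
      using dom_set_comp[OF k(2), of i] sk i(2) by auto
  qed
  consider "k \<in> tree_cols" "m \<in> tree_cols" | K where "k \<in> Fk K" "K \<in> comps" "m \<in> tree_cols"
    | K where "m \<in> Fk K" "K \<in> comps" "k \<in> tree_cols"
    | K L where "k \<in> Fk K" "K \<in> comps" "m \<in> Fk L" "L \<in> comps"
    using k m unfolding all_cols_def by blast
  then show ?thesis
  proof cases
    case 1
    then obtain i j where "i \<in> N" "j \<in> N" "k = (col i, dom_set i)" "m = (col j, dom_set j)"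
      unfolding tree_cols_def by blast
    moreover from this have "i \<noteq> j"
      using km by blast
    ultimately show ?thesis
      using tree_laminar[of i j] by simp
  next
    case 2
    then show ?thesis using mixed by blast
  next
    case 3
    then show ?thesis using mixed[OF 3] by blast
  next
    case 4
    show ?thesis
    proof (cases "K = L")
      case True
      then show ?thesis
        using comps_family[OF 4(2)] 4(1,3) km unfolding column_family_def by blast
    next
      case False
      then show ?thesis
        using comps_disjoint[OF 4(2,4)] comps_snd[OF 4(2,1)] comps_snd[OF 4(4,3)] by blast
    qed
  qed
qed

text \<open>An edge that touches a column lies in the subgraph of the upper column it touches; an
  edge within a leftover set stays in one component and is handled by the family of that
  component.\<close>

lemma all_edges:
  assumes e: "(u, v) \<in> E" "u \<in> X" "v \<in> X"
  shows "\<exists>k\<in>all_cols. u \<in> snd k \<and> v \<in> snd k \<and> (u \<in> fst k \<or> v \<in> fst k)"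
proof -
  have tree: ?thesis if "i \<in> N" "u \<in> dom_set i" "v \<in> dom_set i" "u \<in> col i \<or> v \<in> col i" for i
  proof -
    have "(col i, dom_set i) \<in> all_cols"
      using that(1) unfolding all_cols_def tree_cols_def by blast
    then show ?thesis
      using that(2-4) by force
  qed
  have down': "lft j \<subseteq> dom_set i" if "j \<in> N - {rt}" "j = i \<or> par j = i" for i j
    using lft_dom[of _ j i] that sub_refl sub_par by blast
  from e show ?thesis
  proof (cases rule: adj)
    case (col i)
    then show ?thesis using tree[of i] col_dom_set by blast
  next
    case (lft j)
    obtain K where K: "component E (lft j) K" "u \<in> K"
      using component_ex[OF lft(2)] by blast
    then have Kc: "K \<in> comps"
      using lft(1) unfolding comps_def by blast
    have "v \<in> K"
      using K lft(3) e(1) unfolding component_def by blast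
    then obtain k where "k \<in> Fk K" "u \<in> snd k" "v \<in> snd k" "u \<in> fst k \<or> v \<in> fst k"
      using comps_family[OF Kc] K(2) e(1) unfolding column_family_def by blast
    then show ?thesis
      using Kc unfolding all_cols_def by blast
  next
    case (child i)
    have "u \<in> dom_set (par i)"
      using col_dom[OF child(2,1)] sub_par[OF child(1)] by blast
    then show ?thesis
      using tree[of "par i"] child col_dom_set par_N by blast
  next
    case (parent j)
    have "v \<in> dom_set (par j)"
      using col_dom[OF parent(3,1)] sub_par[OF parent(1)] by blast
    then show ?thesis
      using tree[of "par j"] parent col_dom_set par_N by blast
  next
    case (down i j)
    then show ?thesis
      using tree[of i] down' col_dom_set by blast
  next
    case (up i j)
    then show ?thesis
      using tree[of i] down' col_dom_set by blast
  qed
qed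

lemma tree_geodesic:
  assumes i: "i \<in> N"
  shows "\<exists>Pi pos. geodesic (dom_set i) Pi pos \<and> (\<forall>x\<in>col i. \<exists>y\<in>Pi \<inter> col i. nr (col i) (2 * w) x y)"
proof -
  obtain P u v where P: "is_path E (dom_set i) P u v"
    "\<And>Q. is_path E (dom_set i) Q u v \<Longrightarrow> plen wt P \<le> plen wt Q"
    "\<forall>x\<in>col i. \<exists>y\<in>set P \<inter> col i. \<exists>Q. is_path E (col i) Q x y \<and> plen wt Q \<le> 2 * w"
    using bspec[OF shortcut i] unfolding Let_def dom_set_def[symmetric] by blast
  obtain pos where "geodesic (dom_set i) (set P) pos"
    by (rule shortest_path_geodesic[OF P(1,2)])
  then show ?thesis
    using P(3) unfolding near_def by blast
qed

lemma all_family: "column_family w X all_cols"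
  unfolding column_family_def
proof (intro conjI ballI impI)
  have "finite (Fk K)" if "K \<in> comps" for K
    using comps_family[OF that] unfolding column_family_def by blast
  then show "finite all_cols"
    using finite_comps root(1) unfolding all_cols_def tree_cols_def by simp
next
  fix k assume k: "k \<in> all_cols"
  then consider i where "i \<in> N" "k = (col i, dom_set i)" | K where "K \<in> comps" "k \<in> Fk K"
    unfolding all_cols_def tree_cols_def by blast
  then have "fst k \<noteq> {} \<and> fst k \<subseteq> snd k \<and> snd k \<subseteq> X \<and>
      (\<exists>Pi pos. geodesic (snd k) Pi pos \<and> (\<forall>x\<in>fst k. \<exists>y\<in>Pi \<inter> fst k. nr (fst k) (2 * w) x y))"
  proof cases
    case 1
    then show ?thesis
      using col_ne col_dom_set dom_X tree_geodesic by simp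
  next
    case 2
    have "K \<subseteq> X"
      using compsE[OF 2(1)] by metis
    then have "fst k \<noteq> {} \<and> fst k \<subseteq> snd k \<and> snd k \<subseteq> X"
      using comps_snd[OF 2] by blast
    moreover have "\<exists>Pi pos. geodesic (snd k) Pi pos \<and> (\<forall>x\<in>fst k. \<exists>y\<in>Pi \<inter> fst k. nr (fst k) (2 * w) x y)"
      using comps_family[OF 2(1)] 2(2) unfolding column_family_def by blast
    ultimately show ?thesis by blast
  qed
  then show "fst k \<noteq> {}" "fst k \<subseteq> snd k" "snd k \<subseteq> X"
    "\<exists>Pi pos. geodesic (snd k) Pi pos \<and> (\<forall>x\<in>fst k. \<exists>y\<in>Pi \<inter> fst k. nr (fst k) (2 * w) x y)"
    by blast+
next
  fix v assume "v \<in> X"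
  then consider i where "i \<in> N" "v \<in> col i" | K where "K \<in> comps" "v \<in> K"
    using comps_cover by blast
  then show "\<exists>k\<in>all_cols. v \<in> fst k"
  proof cases
    case 1
    then have "(col i, dom_set i) \<in> all_cols"
      unfolding all_cols_def tree_cols_def by blast
    then show ?thesis
      using 1(2) by force
  next
    case 2
    then obtain k where "k \<in> Fk K" "v \<in> fst k"
      using comps_family[OF 2(1), unfolded column_family_def, THEN conjunct2, THEN conjunct2, THEN conjunct1]
        2(2) by blast
    then show ?thesis
      using 2(1) unfolding all_cols_def by blast
  qed
next
  fix k m assume "k \<in> all_cols" "m \<in> all_cols" "k \<noteq> m"
  then show "snd k \<inter> snd m = {} \<or>
    (snd k \<subseteq> snd m \<and> fst m \<inter> snd k = {}) \<or> (snd m \<subseteq> snd k \<and> fst k \<inter> snd m = {})"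
    by (rule all_laminar)
next
  fix u v assume "u \<in> X" "v \<in> X" "(u, v) \<in> E"
  then show "\<exists>k\<in>all_cols. u \<in> snd k \<and> v \<in> snd k \<and> (u \<in> fst k \<or> v \<in> fst k)"
    using all_edges by blast
qed

lemma tree_close: "0 \<le> B \<Longrightarrow> real (card (close_columns tree_cols B x)) \<le> B / w + 2"
proof -
  assume B: "0 \<le> B"
  let ?I = "{i \<in> N. \<exists>a\<in>col i. nr (dom_set i) B a x}"
  have "close_columns tree_cols B x = (\<lambda>i. (col i, dom_set i)) ` ?I"
    unfolding close_columns_def tree_cols_def Compr_image_eq fst_conv snd_conv ..
  moreover have "finite ?I"
    using root(1) by simp
  ultimately have "card (close_columns tree_cols B x) \<le> card ?I"
    using card_image_le by simp
  then show ?thesis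
    using tree_width[OF B, of x] by linarith
qed

lemma close_col:
  assumes x: "x \<in> col i" "i \<in> N"
  shows "close_columns all_cols B x = close_columns tree_cols B x"
proof -
  have "x \<notin> snd k" if "K \<in> comps" "k \<in> Fk K" for K k
    using comps_snd[OF that] comps_not_col[OF that(1) _ x(2)] x(1) by blast
  then have "close_columns (\<Union>K\<in>comps. Fk K) B x = {}"
    by (intro close_columns_empty) auto
  then show ?thesis
    unfolding all_cols_def close_columns_Un by simp
qed

text \<open>The subgraphs of a child family stay inside their component, and components are
  disjoint, so only one child contributes.\<close>

lemma close_comp:
  assumes x: "x \<in> K" "K \<in> comps"
  shows "close_columns all_cols B x = close_columns tree_cols B x \<union> close_columns (Fk K) B x"
proof -
  have "L = K" if k: "L \<in> comps" "k \<in> Fk L" "x \<in> snd k" for L k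
    using comps_snd[OF k(1,2)] comps_disjoint[OF k(1) x(2)] x(1) k(3) by blast
  then have "close_columns (\<Union>L\<in>comps - {K}. Fk L) B x = {}"
    by (intro close_columns_empty) auto
  moreover have "all_cols = tree_cols \<union> (Fk K \<union> (\<Union>L\<in>comps - {K}. Fk L))"
    using x(2) unfolding all_cols_def by blast
  ultimately show ?thesis
    by (simp add: close_columns_Un)
qed

lemma close_comp_card:
  assumes x: "x \<in> K" "K \<in> comps"
  shows "real (card (close_columns all_cols B x)) \<le>
    real (card (close_columns tree_cols B x)) + real (card (close_columns (Fk K) B x))"
  unfolding close_comp[OF x] using card_Un_le[of "close_columns tree_cols B x"] by (metis of_nat_add of_nat_mono)

lemma enter_comp:
  assumes Q: "is_path E X Q a x" "a \<notin> K" "x \<in> K" "K \<in> comps"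
  obtains xs z zs where "Q = xs @ z # zs" "z \<in> K" "\<exists>c\<in>\<Union>i\<in>N. col i. (z, c) \<in> E"
    "is_path E K (z # zs) z x"
proof -
  obtain xs y z zs where *: "Q = xs @ y # z # zs" "y \<notin> K" "set (z # zs) \<subseteq> K" "(y, z) \<in> E" "y \<in> X" "z \<in> X"
    using last_entry[OF Q(1-3)] by blast
  have "y \<in> (\<Union>i\<in>N. col i)"
    using comps_edge[OF Q(4) _ *(4,5,2)] *(3) by simp
  moreover have "is_path E K (z # zs) z x"
    using is_path_suffix[of E X "xs @ [y]" z zs a x K] Q(1) *(1,3) by simp
  ultimately show thesis
    using that[of "xs @ [y]" z zs] * E_sym by auto
qed

text \<open>If a column of this tree is close to \<open>x\<close> in the component \<open>K\<close>,
  the path from it enters \<open>K\<close> at an outer vertex with at most \<open>B\<close> left,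
  and \<open>few_close_from\<close> with \<open>B' = B\<close> gives
  \<open>(B / w + 2) + (B / w + 2) * (B / w + 1) = (B / w + 2)^2\<close>. Otherwise only the child
  contributes and the bound does not grow.\<close>

lemma all_few: "few_close w X all_cols"
  unfolding few_close_def
proof (intro allI impI)
  fix B x assume B: "0 \<le> (B :: real)" and x: "x \<in> X"
  have Bw: "0 \<le> B / w"
    using B w_pos by simp
  have T: "real (card (close_columns tree_cols B x)) \<le> B / w + 2"
    using tree_close[OF B] .
  show "real (card (close_columns all_cols B x)) \<le> (B / w + 2)\<^sup>2"
  proof (cases "\<exists>i\<in>N. x \<in> col i")
    case True
    then have "real (card (close_columns all_cols B x)) \<le> B / w + 2"
      using T close_col by auto
    also have "\<dots> \<le> (B / w + 2)\<^sup>2"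
      using Bw unfolding power2_eq_square by (simp add: mult_le_cancel_left1)
    finally show ?thesis .
  next
    case False
    then obtain K where K: "x \<in> K" "K \<in> comps"
      using comps_cover[OF x] by blast
    show ?thesis
    proof (cases "close_columns tree_cols B x = {}")
      case True
      have "real (card (close_columns (Fk K) B x)) \<le> (B / w + 2)\<^sup>2"
        using comps_few[OF K(2)] B K(1) unfolding few_close_def by blast
      then show ?thesis
        using close_comp[OF K, of B] True by simp
    next
      case False
      then obtain i a where i: "i \<in> N" "a \<in> col i" "nr (dom_set i) B a x"
        unfolding close_columns_def tree_cols_def by auto
      then obtain Q where Q: "is_path E X Q a x" "plen wt Q \<le> B"
        using near_mono[OF i(3) dom_X order_refl] unfolding near_def by blast
      have "a \<notin> K"
        using comps_not_col[OF K(2)] i(1,2) by blast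
      then obtain xs z zs where z: "Q = xs @ z # zs" "z \<in> K" "\<exists>c\<in>\<Union>i\<in>N. col i. (z, c) \<in> E"
        "is_path E K (z # zs) z x"
        using enter_comp[OF Q(1) _ K] by blast
      have "plen wt (z # zs) \<le> B"
        using plen_infix_le[of xs "z # zs" "[]"] is_pathD(4)[OF Q(1)] Q(2) z(1) by simp
      then have "nr K B z x"
        using z(4) unfolding near_def by blast
      then have "real (card (close_columns (Fk K) B x)) \<le> (B / w + 2) * (B / w + 1)"
        using comps_few_from[OF K(2)] B z(2,3) unfolding few_close_from_def by blast
      then have "real (card (close_columns all_cols B x)) \<le> (B / w + 2) + (B / w + 2) * (B / w + 1)"
        using close_comp_card[OF K, of B] T by linarith
      then show ?thesis
        by (simp add: power2_eq_square algebra_simps)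
    qed
  qed
qed

text \<open>By layer width no vertex within \<open>w\<close> of the outer vertex \<open>v\<close> is
  in a leftover set. So the path spends more than \<open>w\<close> before it enters the component at
  \<open>z\<close>, an outer vertex of the child, and the bound for the child applies with
  \<open>B' - w\<close>; the columns of this tree make up the difference.\<close>

lemma all_few_from: "few_close_from w X C all_cols"
  unfolding few_close_from_def
proof (intro allI impI)
  fix B B' x v assume B: "0 \<le> (B :: real)" and v: "v \<in> X" "\<exists>c\<in>C. (v, c) \<in> E" and near: "nr X B' v x"
  have Bw: "0 \<le> B / w" "0 \<le> B' / w"
    using B near_nonneg[OF near] w_pos by simp_all
  have T: "real (card (close_columns tree_cols B x)) \<le> B / w + 2"
    using tree_close[OF B] .
  have layer: "u \<in> (\<Union>i\<in>N. col i)" if "u \<in> X" "nr X w u v" for u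
    using layer_width v that by blast
  show "real (card (close_columns all_cols B x)) \<le> (B / w + 2) * (B' / w + 1)"
  proof (cases "\<exists>i\<in>N. x \<in> col i")
    case True
    then have "real (card (close_columns all_cols B x)) \<le> (B / w + 2) * 1"
      using T close_col by auto
    also have "\<dots> \<le> (B / w + 2) * (B' / w + 1)"
      using Bw by (intro mult_left_mono) auto
    finally show ?thesis .
  next
    case False
    have "x \<in> X"
      using near_mem[OF near] by simp
    then obtain K where K: "x \<in> K" "K \<in> comps"
      using False comps_cover by blast
    obtain Q where Q: "is_path E X Q v x" "plen wt Q \<le> B'"
      using near unfolding near_def by blast
    have "v \<in> (\<Union>i\<in>N. col i)"
      using layer[OF v(1)] near_refl[OF v(1)] w_pos by simp
    then have "v \<notin> K"
      using comps_not_col[OF K(2)] by blast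
    then obtain xs z zs where z: "Q = xs @ z # zs" "z \<in> K" "\<exists>c\<in>\<Union>i\<in>N. col i. (z, c) \<in> E"
      "is_path E K (z # zs) z x"
      using enter_comp[OF Q(1) _ K] by blast
    have "z \<notin> (\<Union>i\<in>N. col i)"
      using comps_not_col[OF K(2) z(2)] by blast
    moreover have zX: "z \<in> X"
      using is_pathD(3)[OF Q(1)] z(1) by simp
    ultimately have far: "\<not> nr X w z v"
      using layer by blast
    have "is_path E X (xs @ [z]) v z"
      using is_path_prefix Q(1) unfolding z(1) .
    then have "nr X (plen wt (xs @ [z])) v z"
      unfolding near_def by blast
    then have "w < plen wt (xs @ [z])"
      using far near_mono[OF near_sym order_refl] by (meson not_le)
    moreover have "plen wt Q = plen wt (xs @ [z]) + plen wt (z # zs)"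
      unfolding z(1) by (rule plen_split)
    ultimately have "plen wt (z # zs) \<le> B' - w"
      using Q(2) by linarith
    then have "nr K (B' - w) z x"
      using z(4) unfolding near_def by blast
    then have "real (card (close_columns (Fk K) B x)) \<le> (B / w + 2) * ((B' - w) / w + 1)"
      using comps_few_from[OF K(2)] B z(2,3) unfolding few_close_from_def by blast
    also have "(B' - w) / w + 1 = B' / w"
      using w_pos by (simp add: field_simps)
    finally have "real (card (close_columns all_cols B x)) \<le> (B / w + 2) + (B / w + 2) * (B' / w)"
      using close_comp_card[OF K, of B] T by linarith
    then show ?thesis
      by (simp add: algebra_simps)
  qed
qed

end

section \<open>Induction over the hierarchy\<close>

context weighted_graph
begin

lemma hier_column_family:
  assumes "hier E wt w X C" "X \<subseteq> V"
  shows "w > 0 \<and> (\<exists>F. column_family w X F \<and> few_close w X F \<and> few_close_from w X C F)"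
  using assms
proof (induction rule: hier.induct)
  case (1 X N rt par col lft C)
  interpret gridtree_on V E wt w X N rt par col lft
    using 1 by unfold_locales simp_all
  have "\<exists>F. column_family w K F \<and> few_close w K F \<and> few_close_from w K (\<Union>i\<in>N. col i) F"
    if j: "j \<in> N - {rt}" and K: "component E (lft j) K" for j K
  proof -
    have "K \<subseteq> lft j"
      using K unfolding component_def by blast
    then have "K \<subseteq> V"
      using lft_X[OF j] X_sub by blast
    then show ?thesis
      using 1(4) j K by blast
  qed
  \<comment> \<open>The choice must depend on the component alone, because \<open>Fk\<close> is a
    function of \<open>K\<close>.\<close>
  then have "\<exists>F. column_family w K F \<and> few_close w K F \<and> few_close_from w K (\<Union>i\<in>N. col i) F"
    if "\<exists>j\<in>N - {rt}. component E (lft j) K" for K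
    using that by blast
  then obtain Fk where Fk: "\<And>K. \<exists>j\<in>N - {rt}. component E (lft j) K \<Longrightarrow>
    column_family w K (Fk K) \<and> few_close w K (Fk K) \<and> few_close_from w K (\<Union>i\<in>N. col i) (Fk K)"
    by metis
  interpret layered_gridtree V E wt w X N rt par col lft C Fk
  proof
    fix u v c assume "u \<in> X" "v \<in> X" "c \<in> C" "(v, c) \<in> E" "nr X w u v"
    then show "u \<in> (\<Union>i\<in>N. col i)"
      using 1(3) unfolding near_def by blast
  next
    fix j K assume "j \<in> N - {rt}" "component E (lft j) K"
    then have "\<exists>j\<in>N - {rt}. component E (lft j) K"
      by (rule rev_bexI)
    from Fk[OF this] show "column_family w K (Fk K)" "few_close w K (Fk K)"
      "few_close_from w K (\<Union>i\<in>N. col i) (Fk K)"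
      by simp_all
  qed
  show ?case
    using w_pos all_family all_few all_few_from by blast
qed

lemma hierarchy_clustering:
  assumes "has_gridtree_hierarchy V E wt w"
  shows "w > 0 \<and> (\<exists>\<C>. clustering E V \<C> \<and> (\<forall>C\<in>\<C>. strong_diam_le E wt C (6 * w)) \<and>
     (\<forall>u v P. is_path E V P u v \<longrightarrow> real (path_cost E \<C> P u v) \<le> hop_bound 9 * (plen wt P / w + 1)))"
proof -
  obtain F where w: "w > 0" and F: "column_family w V F" and few: "few_close w V F"
    using hier_column_family assms unfolding has_gridtree_hierarchy_def by blast
  have "\<forall>k\<in>F. \<exists>Pi pos. geodesic (snd k) Pi pos \<and> (\<forall>x\<in>fst k. \<exists>y\<in>Pi \<inter> fst k. nr (fst k) (2 * w) x y)"
    using F unfolding column_family_def by blast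
  then obtain Pi pos where geo: "\<And>k. k \<in> F \<Longrightarrow> geodesic (snd k) (Pi k) (pos k)"
    "\<And>k x. k \<in> F \<Longrightarrow> x \<in> fst k \<Longrightarrow> \<exists>y\<in>Pi k \<inter> fst k. nr (fst k) (2 * w) x y"
    by metis
  have F': "finite F" "\<forall>k\<in>F. fst k \<noteq> {} \<and> fst k \<subseteq> snd k \<and> snd k \<subseteq> V" "\<forall>v\<in>V. \<exists>k\<in>F. v \<in> fst k"
    "\<forall>k\<in>F. \<forall>m\<in>F. k \<noteq> m \<longrightarrow> snd k \<inter> snd m = {} \<or>
        (snd k \<subseteq> snd m \<and> fst m \<inter> snd k = {}) \<or> (snd m \<subseteq> snd k \<and> fst k \<inter> snd m = {})"
    "\<forall>u\<in>V. \<forall>v\<in>V. (u, v) \<in> E \<longrightarrow> (\<exists>k\<in>F. u \<in> snd k \<and> v \<in> snd k \<and> (u \<in> fst k \<or> v \<in> fst k))"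
    using F unfolding column_family_def by - (elim conjE, assumption)+
  interpret column_system V E wt w F Pi pos
  proof
    show "w > 0" "finite F"
      by fact+
    show "fst k \<noteq> {} \<and> fst k \<subseteq> snd k \<and> snd k \<subseteq> V" if "k \<in> F" for k
      using bspec[OF F'(2) that] .
    show "\<exists>k\<in>F. v \<in> fst k" if "v \<in> V" for v
      using bspec[OF F'(3) that] .
    show "snd k \<inter> snd m = {} \<or>
      (snd k \<subseteq> snd m \<and> fst m \<inter> snd k = {}) \<or> (snd m \<subseteq> snd k \<and> fst k \<inter> snd m = {})"
      if "k \<in> F" "m \<in> F" "k \<noteq> m" for k m
      using F'(4)[rule_format, OF that] .
    show "\<exists>k\<in>F. u \<in> snd k \<and> v \<in> snd k \<and> (u \<in> fst k \<or> v \<in> fst k)" if "(u, v) \<in> E" for u v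
      using F'(5)[rule_format, OF _ _ that] E_sub[OF that] by simp
    show "geodesic (snd k) (Pi k) (pos k)" if "k \<in> F" for k
      by (rule geo(1)[OF that])
    show "\<exists>y\<in>Pi k \<inter> fst k. nr (fst k) (2 * w) x y" if "k \<in> F" "x \<in> fst k" for k x
      by (rule geo(2)[OF that])
    show "real (card {k \<in> F. \<exists>a\<in>fst k. nr (snd k) B a x}) \<le> (B / w + 2)\<^sup>2" if "0 \<le> B" "x \<in> V" for B x
      using few[unfolded few_close_def close_columns_def, rule_format, OF that] .
  qed
  show ?thesis
    using w ex_clustering by blast
qed

end

theorem theorem3p3:
  shows "\<exists>c1 c2 c3 :: real. \<forall>(V :: nat set) E wt (\<epsilon> :: real) (t :: real).
    0 < \<epsilon> \<and> \<epsilon> < 1 \<and> 0 < t \<and> t \<le> 1/8 \<and>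
    wgraph V E wt \<and> connected_in E V \<and>
    has_gridtree_hierarchy V E wt (t * \<epsilon> * diameter E wt V) \<longrightarrow>
    (\<exists>\<C>. clustering E V \<C> \<and>
       (\<forall>C\<in>\<C>. strong_diam_le E wt C (c1 * \<epsilon> * diameter E wt V)) \<and>
       (\<forall>u\<in>V. \<forall>v\<in>V. real (cost_s E wt V \<C> (8 * t) u v)
          \<le> c2 / (t * \<epsilon>) * (dist_in E wt V u v / diameter E wt V) + c3))"
proof (rule exI[of _ 1], rule exI[of _ "real (hop_bound 9)"], rule exI[of _ "real (hop_bound 9)"],
    intro allI impI, elim conjE)
  fix V :: "nat set" and E wt and \<epsilon> t :: real
  assume \<epsilon>: "0 < \<epsilon>" and t: "0 < t" "t \<le> 1 / 8" and g: "wgraph V E wt" and conn: "connected_in E V"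
    and hier: "has_gridtree_hierarchy V E wt (t * \<epsilon> * diameter E wt V)"
  define \<Delta> where "\<Delta> = diameter E wt V"
  define w where "w = t * \<epsilon> * \<Delta>"
  define H where "H = real (hop_bound 9)"
  interpret weighted_graph V E wt
    by (rule weighted_graph.intro[OF g])
  obtain \<C> where w: "w > 0" and \<C>: "clustering E V \<C>" and diam: "\<forall>C\<in>\<C>. strong_diam_le E wt C (6 * w)"
    and cost: "\<And>u v P. is_path E V P u v \<Longrightarrow> real (path_cost E \<C> P u v) \<le> H * (plen wt P / w + 1)"
    using hierarchy_clustering[OF hier] unfolding w_def \<Delta>_def H_def by blast
  \<comment> \<open>Every gridtree has positive width, which excludes diameter 0.\<close>
  have "\<Delta> > 0"
    using w zero_less_mult_pos[of "t * \<epsilon>" \<Delta>] \<epsilon> t unfolding w_def by simp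
  \<comment> \<open>From \<open>t \<le> 1 / 8\<close> follows \<open>6 * t \<le> 1\<close>, so the
    diameter bound holds with constant 1.\<close>
  then have "(6 * t) * (\<epsilon> * \<Delta>) \<le> 1 * (\<epsilon> * \<Delta>)"
    using \<epsilon> t by (intro mult_right_mono) auto
  then have "6 * w \<le> 1 * \<epsilon> * \<Delta>"
    unfolding w_def by (simp add: algebra_simps)
  then have "\<forall>C\<in>\<C>. strong_diam_le E wt C (1 * \<epsilon> * \<Delta>)"
    using diam unfolding strong_diam_le_def by (meson order_trans)
  moreover have "real (cost_s E wt V \<C> (8 * t) u v) \<le> H / (t * \<epsilon>) * (dist_in E wt V u v / \<Delta>) + H"
    if uv: "u \<in> V" "v \<in> V" for u v
  proof -
    obtain P0 where "is_path E V P0 u v"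
      using conn uv unfolding connected_in_def by blast
    \<comment> \<open>A shortest path is itself admissible in \<open>cost_s\<close>, since
      \<open>8 * t\<close> is positive.\<close>
    then obtain P where P: "is_path E V P u v" "plen wt P = dist_in E wt V u v"
      using dist_in_attained[OF subset_refl] by metis
    have "1 * plen wt P \<le> (1 + 8 * t) * dist_in E wt V u v"
      unfolding P(2)[symmetric] using plen_nonneg[OF is_pathD(4)[OF P(1)]] t(1)
      by (intro mult_right_mono) auto
    then have "cost_s E wt V \<C> (8 * t) u v \<le> path_cost E \<C> P u v"
      unfolding cost_s_def using P(1) by (intro Least_le exI[of _ P]) simp
    then have "real (cost_s E wt V \<C> (8 * t) u v) \<le> H * (plen wt P / w + 1)"
      using cost[OF P(1)] by linarith
    also have "\<dots> = H / (t * \<epsilon>) * (dist_in E wt V u v / \<Delta>) + H"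
      unfolding P(2) w_def by (simp add: algebra_simps)
    finally show ?thesis .
  qed
  ultimately show "\<exists>\<C>. clustering E V \<C> \<and>
       (\<forall>C\<in>\<C>. strong_diam_le E wt C (1 * \<epsilon> * diameter E wt V)) \<and>
       (\<forall>u\<in>V. \<forall>v\<in>V. real (cost_s E wt V \<C> (8 * t) u v)
          \<le> real (hop_bound 9) / (t * \<epsilon>) * (dist_in E wt V u v / diameter E wt V) + real (hop_bound 9))"
    using \<C> unfolding \<Delta>_def H_def by blast
qed

end
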